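(* Let $\mathcal H$ be a hereditary $\mathcal L$-property, where $\mathcal L$ is a finite relational language of maximum arity $r\ge 2$. Then the following hold. 1. If $\pi(\mathcal H)>1$, then $|\mathcal H_n|=\pi(\mathcal H)^{\binom{n}{r}+o(n^r)}$. 2. If $\pi(\mathcal H)\le 1$, then $|\mathcal H_n|=2^{o(n^r)}$.
   Context: $\mathcal L$ is a finite relational first-order language with maximum arity $r\ge 2$. All formulas and types are quantifier-free. $\binom{V}{r}$ is the set of $r$-element subsets of $V$; $V^{\underline r}$ is the set of $r$-tuples of pairwise distinct elements of $V$; for $\bar a=(a_1,\dots,a_r)$, $\cup\bar a=\{a_1,\dots,a_r\}$ and, for a permutation $\mu$ of $[r]$, $\mu(\bar a)=(a_{\mu(1)},\dots,a_{\mu(r)})$. The size of a structure is the cardinality of its domain. A hereditary $\mathcal L$-property is a nonempty class of finite $\mathcal L$-structures closed under isomorphism and (model-theoretic, i.e. induced) substructures. $\mathcal H_n$ is the set of elements of $\mathcal H$ with domain $[n]=\{1,\dots,n\}$. Types: for an $\mathcal L$-structure $N$ and a tuple $\bar a$, $qftp^N(\bar a)$ is the set of quantifier-free $\mathcal L$-formulas $\phi(\bar x)$ with $N\models\phi(\bar a)$. $S_r(\mathcal H)$ is the set of complete quantifier-free $r$-types $p(x_1,\dots,x_r)$ that are proper (contain $x_i\ne x_j$ for $i\neq j$) and are realized in some element of $\mathcal H$. For a set $V$ let $C_V=\{c_v:v\in V\}$ be new constants; for $\bar a\in V^{\underline r}$, $p(c_{\bar a})$ is the set of sentences obtained by substituting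 $c_{a_i}$ for $x_i$; $S_r(C_V,\mathcal H)=\{p(c_{\bar a}):p\in S_r(\mathcal H),\bar a\in V^{\underline r}\}$. For an $\mathcal L$-structure $N$ and $A\subseteq \mathrm{dom}(N)$, $Diag^N(A)$ is the set of quantifier-free sentences in $\mathcal L\cup C_A$ true in $N$ when $c_a$ names $a$. $\mathcal L_{\mathcal H}=\{R_p:p\in S_r(\mathcal H)\}$ is the language with one $r$-ary relation symbol per element of $S_r(\mathcal H)$. An $\mathcal L_{\mathcal H}$-structure $M$ with domain $V$ is complete if for every $A\in\binom Vr$ there are an enumeration $\bar a$ of $A$ and $R_p\in\mathcal L_{\mathcal H}$ with $M\models R_p(\bar a)$. $M$ is an $\mathcal L_{\mathcal H}$-template if it is complete and (1) $M\models\neg R_p(\bar a)$ for all $p\in S_r(\mathcal H)$, $\bar a\in V^r\setminus V^{\underline r}$; (2) whenever $p,p'\in S_r(\mathcal H)$ and a permutation $\mu$ of $[r]$ satisfy $p(\bar x)=p'(\mu(\bar x))$, then for all $\bar a\in V^{\underline r}$, $M\models R_p(\bar a)$ iff $M\models R_{p'}(\mu(\bar a))$. For $A\in\binom Vr$, $Ch_M(A)=\{p(c_{\bar a})\in S_r(C_V,\mathcal H):\cup\bar a=A,\ M\models R_p(\bar a)\}$. A choice function for $M$ is $\chi:\binom Vr\to S_r(C_V,\mathcal H)$ with $\chi(A)\in Ch_M(A)$ for all $A$. For complete $M$, an $\mathcal L$-structure $N$ with domain $V$ is a full subpattern of $M$ chosen by $\chi$, written $N\unlhd_\chi M$, if $Diag^N(A)=\chi(A)$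 for all $A\in\binom Vr$; $N\unlhd_p M$ means $N\unlhd_\chi M$ for some choice function $\chi$. $sub(M)=|\{N:N\unlhd_pM\}|$ for finite $M$. $M$ is $\mathcal H$-random if it is complete and for every choice function $\chi$ there is $N\in\mathcal H$ with $N\unlhd_\chi M$. $\mathcal R(n,\mathcal H)$ is the class of all $\mathcal H$-random $\mathcal L_{\mathcal H}$-templates of size $n$. $ex(n,\mathcal H)=\max\{sub(M):M\in\mathcal R(n,\mathcal H)\}$ with $\max\emptyset=0$, and $\pi(\mathcal H)=\lim_{n\to\infty}ex(n,\mathcal H)^{1/\binom nr}$ (this limit exists for every hereditary $\mathcal L$-property). Convention: $|\mathcal H_n|=2^{o(n^r)}$ means that for every $\eta>0$, $|\mathcal H_n|\le 2^{\eta n^r}$ for all sufficiently large $n$ (in particular $|\mathcal H_n|=0$ is allowed). *)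

theory Defs
  imports Complex_Main "HOL-Library.Landau_Symbols" "HOL-Library.Ramsey"
    "HOL-Combinatorics.Permutations"
begin

section \<open>Relational languages and structures\<close>

record 's rel_lang =
  symbols :: "'s set"
  sym_arity :: "'s \<Rightarrow> nat"

record ('s, 'a) rel_struct =
  universe :: "'a set"
  interp :: "'s \<Rightarrow> 'a list set"

definition tuples :: "'a set \<Rightarrow> nat \<Rightarrow> 'a list set" where
  "tuples V k = {a. length a = k \<and> set a \<subseteq> V}"

definition distinct_tuples :: "'a set \<Rightarrow> nat \<Rightarrow> 'a list set" where
  "distinct_tuples V k = {a \<in> tuples V k. distinct a}"

text \<open>As usual in model theory, domains are nonempty.  Symbols outside the language are
  interpreted by the empty relation, so that equality of records is equality of structures and
  structures can be counted with \<open>card\<close>.\<close>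

definition is_structure :: "'s rel_lang \<Rightarrow> ('s, 'a) rel_struct \<Rightarrow> bool" where
  "is_structure L N \<longleftrightarrow>
     universe N \<noteq> {} \<and>
     (\<forall>R \<in> symbols L. interp N R \<subseteq> tuples (universe N) (sym_arity L R)) \<and>
     (\<forall>R. R \<notin> symbols L \<longrightarrow> interp N R = {})"

definition isomorphic :: "'s rel_lang \<Rightarrow> ('s, 'a) rel_struct \<Rightarrow> ('s, 'a) rel_struct \<Rightarrow> bool" where
  "isomorphic L N N' \<longleftrightarrow>
     (\<exists>f. bij_betw f (universe N) (universe N') \<and>
        (\<forall>R \<in> symbols L. \<forall>a \<in> tuples (universe N) (sym_arity L R).
           a \<in> interp N R \<longleftrightarrow> map f a \<in> interp N' R))"

definition substructure :: "'s rel_lang \<Rightarrow> ('s, 'a) rel_struct \<Rightarrow> ('s, 'a) rel_struct \<Rightarrow> bool" where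
  "substructure L N' N \<longleftrightarrow>
     universe N' \<subseteq> universe N \<and>
     (\<forall>R \<in> symbols L. interp N' R = interp N R \<inter> tuples (universe N') (sym_arity L R))"

text \<open>A class of finite structures closed under isomorphism is represented by its members whose
  elements are drawn from a fixed infinite type \<open>'a\<close>; below \<open>'a\<close> is \<open>nat\<close>.\<close>

definition hereditary_property :: "'s rel_lang \<Rightarrow> ('s, 'a) rel_struct set \<Rightarrow> bool" where
  "hereditary_property L H \<longleftrightarrow>
     H \<noteq> {} \<and>
     (\<forall>N \<in> H. is_structure L N \<and> finite (universe N)) \<and>
     (\<forall>N \<in> H. \<forall>N'. is_structure L N' \<and> isomorphic L N N' \<longrightarrow> N' \<in> H) \<and>
     (\<forall>N \<in> H. \<forall>N'. is_structure L N' \<and> substructure L N' N \<longrightarrow> N' \<in> H)"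

definition members_on :: "('s, nat) rel_struct set \<Rightarrow> nat \<Rightarrow> ('s, nat) rel_struct set" where
  "members_on H n = {N \<in> H. universe N = {1..n}}"


section \<open>Quantifier-free formulas and types\<close>

text \<open>\<open>Var i\<close> is the variable $x_{i+1}$ and \<open>Cst v\<close> is the constant $c_v$.\<close>

datatype 'a trm = Var nat | Cst 'a

datatype ('s, 't) qff =
    Eq 't 't
  | Rel 's "'t list"
  | Neg "('s, 't) qff"
  | Conj "('s, 't) qff" "('s, 't) qff"
  | Disj "('s, 't) qff" "('s, 't) qff"

type_synonym ('s, 'a) form = "('s, 'a trm) qff"

primrec qf_formula :: "'s rel_lang \<Rightarrow> 't set \<Rightarrow> ('s, 't) qff \<Rightarrow> bool" where
  "qf_formula L T (Eq s t) \<longleftrightarrow> s \<in> T \<and> t \<in> T"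
| "qf_formula L T (Rel R ts) \<longleftrightarrow> R \<in> symbols L \<and> length ts = sym_arity L R \<and> set ts \<subseteq> T"
| "qf_formula L T (Neg \<phi>) \<longleftrightarrow> qf_formula L T \<phi>"
| "qf_formula L T (Conj \<phi> \<psi>) \<longleftrightarrow> qf_formula L T \<phi> \<and> qf_formula L T \<psi>"
| "qf_formula L T (Disj \<phi> \<psi>) \<longleftrightarrow> qf_formula L T \<phi> \<and> qf_formula L T \<psi>"

primrec term_value :: "(nat \<Rightarrow> 'a) \<Rightarrow> 'a trm \<Rightarrow> 'a" where
  "term_value e (Var i) = e i"
| "term_value e (Cst v) = v"

primrec sat :: "('s, 'a) rel_struct \<Rightarrow> (nat \<Rightarrow> 'a) \<Rightarrow> ('s, 'a) form \<Rightarrow> bool" where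
  "sat N e (Eq s t) \<longleftrightarrow> term_value e s = term_value e t"
| "sat N e (Rel R ts) \<longleftrightarrow> map (term_value e) ts \<in> interp N R"
| "sat N e (Neg \<phi>) \<longleftrightarrow> \<not> sat N e \<phi>"
| "sat N e (Conj \<phi> \<psi>) \<longleftrightarrow> sat N e \<phi> \<and> sat N e \<psi>"
| "sat N e (Disj \<phi> \<psi>) \<longleftrightarrow> sat N e \<phi> \<or> sat N e \<psi>"

primrec subst_term :: "(nat \<Rightarrow> 'a trm) \<Rightarrow> 'a trm \<Rightarrow> 'a trm" where
  "subst_term \<sigma> (Var i) = \<sigma> i"
| "subst_term \<sigma> (Cst v) = Cst v"

definition subst_type :: "(nat \<Rightarrow> 'a trm) \<Rightarrow> ('s, 'a) form set \<Rightarrow> ('s, 'a) form set" where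
  "subst_type \<sigma> p = map_qff id (subst_term \<sigma>) ` p"

text \<open>$p(c_{\bar a})$ and $p(\mu(\bar x))$\<close>

definition inst_type :: "('s, 'a) form set \<Rightarrow> 'a list \<Rightarrow> ('s, 'a) form set" where
  "inst_type p a = subst_type (\<lambda>i. Cst (a ! i)) p"

definition permute_type :: "(nat \<Rightarrow> nat) \<Rightarrow> ('s, 'a) form set \<Rightarrow> ('s, 'a) form set" where
  "permute_type \<mu> p = subst_type (\<lambda>i. Var (\<mu> i)) p"

definition qftp :: "'s rel_lang \<Rightarrow> ('s, 'a) rel_struct \<Rightarrow> 'a list \<Rightarrow> ('s, 'a) form set" where
  "qftp L N a = {\<phi>. qf_formula L (Var ` {..<length a}) \<phi> \<and> sat N ((!) a) \<phi>}"

text \<open>A sentence contains no variables, so the assignment \<open>e\<close> is irrelevant.\<close>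

definition Diag :: "'s rel_lang \<Rightarrow> ('s, 'a) rel_struct \<Rightarrow> 'a set \<Rightarrow> ('s, 'a) form set" where
  "Diag L N A = {\<phi>. qf_formula L (Cst ` A) \<phi> \<and> (\<forall>e. sat N e \<phi>)}"

definition complete_type :: "'s rel_lang \<Rightarrow> nat \<Rightarrow> ('s, 'a) form set \<Rightarrow> bool" where
  "complete_type L r p \<longleftrightarrow>
     (\<forall>\<phi> \<in> p. qf_formula L (Var ` {..<r}) \<phi>) \<and>
     (\<forall>\<phi>. qf_formula L (Var ` {..<r}) \<phi> \<longrightarrow> \<phi> \<in> p \<or> Neg \<phi> \<in> p)"

definition proper_type :: "nat \<Rightarrow> ('s, 'a) form set \<Rightarrow> bool" where
  "proper_type r p \<longleftrightarrow> (\<forall>i<r. \<forall>j<r. i \<noteq> j \<longrightarrow> Neg (Eq (Var i) (Var j)) \<in> p)"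

definition realized_in :: "'s rel_lang \<Rightarrow> nat \<Rightarrow> ('s, 'a) form set \<Rightarrow> ('s, 'a) rel_struct \<Rightarrow> bool" where
  "realized_in L r p N \<longleftrightarrow> (\<exists>a \<in> tuples (universe N) r. p \<subseteq> qftp L N a)"

text \<open>The set $S_r(\mathcal H)$; consistency of the types is implied by their realization.\<close>

definition proper_types :: "'s rel_lang \<Rightarrow> nat \<Rightarrow> ('s, 'a) rel_struct set \<Rightarrow> ('s, 'a) form set set" where
  "proper_types L r H =
     {p. complete_type L r p \<and> proper_type r p \<and> (\<exists>N \<in> H. realized_in L r p N)}"

text \<open>The set $S_r(C_V, \mathcal H)$\<close>

definition proper_types_over ::
    "'s rel_lang \<Rightarrow> nat \<Rightarrow> 'a set \<Rightarrow> ('s, 'a) rel_struct set \<Rightarrow> ('s, 'a) form set set" where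
  "proper_types_over L r V H =
     {inst_type p a | p a. p \<in> proper_types L r H \<and> a \<in> distinct_tuples V r}"


section \<open>Templates\<close>

text \<open>The relation symbol $R_p$ of $\mathcal L_{\mathcal H}$ is the type \<open>p\<close> itself.
  Below, \<open>nsets V r\<close> is the set of \<open>r\<close>-element subsets of \<open>V\<close>.\<close>

type_synonym ('s, 'a) tstruct = "(('s, 'a) form set, 'a) rel_struct"

definition type_lang :: "'s rel_lang \<Rightarrow> nat \<Rightarrow> ('s, 'a) rel_struct set \<Rightarrow> ('s, 'a) form set rel_lang" where
  "type_lang L r H = \<lparr>symbols = proper_types L r H, sym_arity = (\<lambda>_. r)\<rparr>"

definition complete_tstruct ::
    "'s rel_lang \<Rightarrow> nat \<Rightarrow> ('s, 'a) rel_struct set \<Rightarrow> ('s, 'a) tstruct \<Rightarrow> bool" where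
  "complete_tstruct L r H M \<longleftrightarrow>
     is_structure (type_lang L r H) M \<and>
     (\<forall>A \<in> nsets (universe M) r.
        \<exists>a \<in> distinct_tuples (universe M) r. set a = A \<and>
          (\<exists>p \<in> proper_types L r H. a \<in> interp M p))"

definition template ::
    "'s rel_lang \<Rightarrow> nat \<Rightarrow> ('s, 'a) rel_struct set \<Rightarrow> ('s, 'a) tstruct \<Rightarrow> bool" where
  "template L r H M \<longleftrightarrow>
     complete_tstruct L r H M \<and>
     (\<forall>p \<in> proper_types L r H.
        \<forall>a \<in> tuples (universe M) r - distinct_tuples (universe M) r. a \<notin> interp M p) \<and>
     (\<forall>p \<in> proper_types L r H. \<forall>p' \<in> proper_types L r H. \<forall>\<mu>.
        \<mu> permutes {..<r} \<and> p = permute_type \<mu> p' \<longrightarrow>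
          (\<forall>a \<in> distinct_tuples (universe M) r.
             a \<in> interp M p \<longleftrightarrow> permute_list \<mu> a \<in> interp M p'))"

definition Ch ::
    "'s rel_lang \<Rightarrow> nat \<Rightarrow> ('s, 'a) rel_struct set \<Rightarrow> ('s, 'a) tstruct \<Rightarrow> 'a set \<Rightarrow> ('s, 'a) form set set"
  where
  "Ch L r H M A =
     {inst_type p a | p a. p \<in> proper_types L r H \<and> a \<in> distinct_tuples (universe M) r \<and>
        set a = A \<and> a \<in> interp M p}"

definition choice_function ::
    "'s rel_lang \<Rightarrow> nat \<Rightarrow> ('s, 'a) rel_struct set \<Rightarrow> ('s, 'a) tstruct \<Rightarrow>
     ('a set \<Rightarrow> ('s, 'a) form set) \<Rightarrow> bool" where
  "choice_function L r H M \<chi> \<longleftrightarrow>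
     (\<forall>A \<in> nsets (universe M) r.
        \<chi> A \<in> proper_types_over L r (universe M) H \<and> \<chi> A \<in> Ch L r H M A)"

definition full_subpattern_by ::
    "'s rel_lang \<Rightarrow> nat \<Rightarrow> ('s, 'a) rel_struct \<Rightarrow> ('a set \<Rightarrow> ('s, 'a) form set) \<Rightarrow>
     ('s, 'a) tstruct \<Rightarrow> bool" where
  "full_subpattern_by L r N \<chi> M \<longleftrightarrow>
     is_structure L N \<and> universe N = universe M \<and>
     (\<forall>A \<in> nsets (universe M) r. Diag L N A = \<chi> A)"

definition full_subpattern ::
    "'s rel_lang \<Rightarrow> nat \<Rightarrow> ('s, 'a) rel_struct set \<Rightarrow> ('s, 'a) rel_struct \<Rightarrow> ('s, 'a) tstruct \<Rightarrow> bool" where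
  "full_subpattern L r H N M \<longleftrightarrow>
     (\<exists>\<chi>. choice_function L r H M \<chi> \<and> full_subpattern_by L r N \<chi> M)"

definition sub_num :: "'s rel_lang \<Rightarrow> nat \<Rightarrow> ('s, 'a) rel_struct set \<Rightarrow> ('s, 'a) tstruct \<Rightarrow> nat" where
  "sub_num L r H M = card {N. full_subpattern L r H N M}"

definition H_random :: "'s rel_lang \<Rightarrow> nat \<Rightarrow> ('s, 'a) rel_struct set \<Rightarrow> ('s, 'a) tstruct \<Rightarrow> bool" where
  "H_random L r H M \<longleftrightarrow>
     complete_tstruct L r H M \<and>
     (\<forall>\<chi>. choice_function L r H M \<chi> \<longrightarrow> (\<exists>N \<in> H. full_subpattern_by L r N \<chi> M))"

definition random_templates ::
    "'s rel_lang \<Rightarrow> nat \<Rightarrow> nat \<Rightarrow> ('s, 'a) rel_struct set \<Rightarrow> ('s, 'a) tstruct set" where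
  "random_templates L r n H =
     {M. template L r H M \<and> H_random L r H M \<and> finite (universe M) \<and> card (universe M) = n}"


section \<open>The extremal function and the limit $\pi(\mathcal H)$\<close>

definition ex_num :: "'s rel_lang \<Rightarrow> nat \<Rightarrow> nat \<Rightarrow> ('s, 'a) rel_struct set \<Rightarrow> nat" where
  "ex_num L r n H =
     (if random_templates L r n H = {} then 0
      else Max (sub_num L r H ` random_templates L r n H))"

definition pi_lim :: "'s rel_lang \<Rightarrow> nat \<Rightarrow> ('s, 'a) rel_struct set \<Rightarrow> real" where
  "pi_lim L r H = lim (\<lambda>n. root (n choose r) (real (ex_num L r n H)))"

end

theory Submission
  imports Defs "HOL-Real_Asymp.Real_Asymp"
begin

text \<open>
  Pick \<open>N\<close> uniformly among the members of \<open>H\<close> with domain \<open>{1..n}\<close>, and regard the diagram of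
  \<open>N\<close> on an \<open>r\<close>-set \<open>A\<close> as the colour of \<open>A\<close>.  Since no symbol has arity above \<open>r\<close>, the colours
  determine \<open>N\<close>, so their joint entropy is \<open>ln |H\<^sub>n|\<close>; and since \<open>H\<close> is closed under isomorphism,
  the entropy of a family of \<open>r\<close>-sets does not change when the vertices are permuted.  The upper
  bound on \<open>|H\<^sub>n|\<close> rests on heredity, this symmetry and the submodularity of entropy.

  Let \<open>e\<^sub>m\<close> be the entropy of the colour of one \<open>r\<close>-subset of an \<open>m\<close>-set given the colours of all its
  other \<open>r\<close>-subsets.  It decreases in \<open>m\<close> and lies between \<open>0\<close> and \<open>ln q\<close>, where \<open>q\<close> bounds the number
  of colours, so for each \<open>k\<close> there is a \<open>t\<close>, bounded independently of \<open>n\<close>, for which \<open>e\<^sub>m\<close> is nearly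
  constant for \<open>m\<close> between \<open>r + t\<close> and \<open>k + t\<close>.  Take disjoint sets \<open>U\<close> and \<open>T\<close> of sizes \<open>k\<close> and \<open>t\<close>,
  and reveal the colours of all \<open>r\<close>-subsets of \<open>U \<union> T\<close> that meet \<open>T\<close>.  Afterwards the colour of
  each \<open>r\<close>-subset of \<open>U\<close> has entropy at most the value of \<open>e\<close> at \<open>r + t\<close>, whereas jointly they still
  have at least \<open>binomial k r\<close> times its value at \<open>k + t\<close>: the colours inside \<open>U\<close> have become nearly
  independent (\<open>nearly_independent_sample\<close>).  This is a finite form of the fact that an exchangeable
  array is conditionally independent given its lower-order information.  The same decoupling with a
  small set \<open>T\<close> gives \<open>ln |H\<^sub>n| \<le> binomial n r * e\<^sub>m + o(n\<^sup>r)\<close> for every fixed \<open>m \<ge> r\<close>.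

  For nearly independent colours, every combination of colours that are not too rare must occur,
  because the relative entropy between the joint law and the product law is at least the product
  mass of the combinations that never occur (\<open>small_excess_imp_box\<close>).  Discarding the rare colours
  costs little entropy.  The frequent colours therefore form an \<open>H\<close>-random template on \<open>U\<close> whose
  number of full subpatterns is about \<open>exp (binomial k r * e\<^sub>m)\<close>, so up to an arbitrarily small error
  \<open>ln |H\<^sub>n| / binomial n r \<le> ln (ex k) / binomial k r\<close> for large \<open>n\<close> (\<open>members_rate_le_ex_rate\<close>).

  Conversely the full subpatterns of an \<open>H\<close>-random template on \<open>n\<close> vertices are members of \<open>H\<close>, so
  \<open>ex n \<le> |H\<^sub>n|\<close>.  Hence, if all \<open>H\<^sub>n\<close> with \<open>n \<ge> 1\<close> are nonempty, both normalised logarithms converge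
  to the same limit \<open>h \<ge> 0\<close>, the limit \<open>\<pi>(H)\<close> exists and equals \<open>exp h\<close>, and both parts of the theorem
  can be read off.  If some \<open>H\<^sub>n\<close> with \<open>n \<ge> 1\<close> is empty, so are all later ones, and \<open>\<pi>(H) = 0\<close>.
\<close>

section \<open>Entropy of a finite uniform distribution\<close>

definition fibre :: "('w \<Rightarrow> 'i \<Rightarrow> 'c) \<Rightarrow> 'w set \<Rightarrow> 'i set \<Rightarrow> 'w \<Rightarrow> 'w set" where
  "fibre X \<Omega> J w = {v \<in> \<Omega>. \<forall>i\<in>J. X v i = X w i}"

text \<open>Shannon entropy, in natural units, of the family of colours \<open>X w i\<close> with \<open>i \<in> J\<close>, when \<open>w\<close> is
  uniform on \<open>\<Omega>\<close>: the probability of the value attained at \<open>w\<close> is the relative size of its fibre.\<close>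

definition entropy :: "('w \<Rightarrow> 'i \<Rightarrow> 'c) \<Rightarrow> 'w set \<Rightarrow> 'i set \<Rightarrow> real" where
  "entropy X \<Omega> J = (\<Sum>w\<in>\<Omega>. ln (real (card \<Omega>) / real (card (fibre X \<Omega> J w)))) / real (card \<Omega>)"

lemma fibre_subset: "fibre X \<Omega> J w \<subseteq> \<Omega>"
  by (auto simp: fibre_def)

lemma finite_fibre: "finite \<Omega> \<Longrightarrow> finite (fibre X \<Omega> J w)"
  by (auto simp: fibre_def)

lemma card_fibre_pos: "finite \<Omega> \<Longrightarrow> w \<in> \<Omega> \<Longrightarrow> card (fibre X \<Omega> J w) > 0"
  by (subst card_gt_0_iff) (auto simp: fibre_def)

lemma fibre_fibre: "v \<in> fibre X \<Omega> J w \<Longrightarrow> fibre X (fibre X \<Omega> J w) K v = fibre X \<Omega> (J \<union> K) v"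
  by (auto simp: fibre_def)

lemma fibre_eq: "v \<in> fibre X \<Omega> J w \<Longrightarrow> fibre X \<Omega> J v = fibre X \<Omega> J w"
  by (auto simp: fibre_def)

lemma fibre_restrict: "fibre X \<Omega> J w = {v \<in> \<Omega>. restrict (X v) J = restrict (X w) J}"
  by (auto simp: fibre_def restrict_def fun_eq_iff)

lemma entropy_empty: "entropy X \<Omega> {} = 0"
  by (cases "card \<Omega> = 0") (auto simp: entropy_def fibre_def)

text \<open>Each value \<open>x\<close> of \<open>k\<close> is counted once for every outcome in its class, with weight one over the
  size of the class.\<close>

lemma sum_over_classes:
  fixes F :: "'x \<Rightarrow> real"
  assumes "finite \<Omega>"
  shows "(\<Sum>w\<in>\<Omega>. F (k w) / real (card {v \<in> \<Omega>. k v = k w})) = sum F (k ` \<Omega>)"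
proof -
  have "(\<Sum>w\<in>\<Omega>. F (k w) / real (card {v \<in> \<Omega>. k v = k w}))
      = (\<Sum>x\<in>k ` \<Omega>. \<Sum>w | w \<in> \<Omega> \<and> k w = x. F (k w) / real (card {v \<in> \<Omega>. k v = k w}))"
    by (rule sum.image_gen [OF assms])
  also have "\<dots> = sum F (k ` \<Omega>)"
  proof (rule sum.cong [OF refl])
    fix x assume "x \<in> k ` \<Omega>"
    then have "card {v \<in> \<Omega>. k v = x} > 0"
      using assms by (subst card_gt_0_iff) auto
    then show "(\<Sum>w | w \<in> \<Omega> \<and> k w = x. F (k w) / real (card {v \<in> \<Omega>. k v = k w})) = F x"
      by simp
  qed
  finally show ?thesis .
qed

text \<open>From \<open>ln z \<le> z - 1\<close>.  The left-hand side is minus the relative entropy of the law of \<open>k w\<close> with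
  respect to the weight \<open>W\<close>.  The entropy inequalities below are instances, with \<open>W\<close> a product of
  marginal probabilities or an explicit weight.  Only values that are attained contribute to
  the right-hand side: for a probability weight the bound is minus the mass of the missing values.\<close>

lemma gibbs_inequality:
  assumes "finite \<Omega>" "\<Omega> \<noteq> {}" and pos: "\<And>w. w \<in> \<Omega> \<Longrightarrow> W (k w) > 0"
  shows "(\<Sum>w\<in>\<Omega>. ln (real (card \<Omega>) * W (k w) / real (card {v \<in> \<Omega>. k v = k w}))) / real (card \<Omega>)
         \<le> sum W (k ` \<Omega>) - 1"
proof -
  let ?c = "\<lambda>w. real (card {v \<in> \<Omega>. k v = k w})"
  have n: "real (card \<Omega>) > 0" using assms by (simp add: card_gt_0_iff)
  have "(\<Sum>w\<in>\<Omega>. ln (real (card \<Omega>) * W (k w) / ?c w))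
      \<le> (\<Sum>w\<in>\<Omega>. real (card \<Omega>) * (W (k w) / ?c w) - 1)"
  proof (rule sum_mono)
    fix w assume w: "w \<in> \<Omega>"
    then have "?c w > 0"
      using assms(1) by (simp add: card_gt_0_iff) auto
    then have "real (card \<Omega>) * W (k w) / ?c w > 0"
      using n pos [OF w] by simp
    from ln_le_minus_one [OF this]
    show "ln (real (card \<Omega>) * W (k w) / ?c w) \<le> real (card \<Omega>) * (W (k w) / ?c w) - 1"
      by simp
  qed
  also have "\<dots> = real (card \<Omega>) * (\<Sum>w\<in>\<Omega>. W (k w) / ?c w) - real (card \<Omega>)"
    by (simp add: sum_subtractf sum_distrib_left)
  also have "\<dots> = real (card \<Omega>) * (sum W (k ` \<Omega>) - 1)"
    unfolding sum_over_classes [OF assms(1), where F = W and k = k] by (simp only: right_diff_distrib mult_1_right)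
  finally show ?thesis using n by (simp add: divide_le_eq mult.commute)
qed

lemma sum_class_probabilities:
  assumes "finite \<Omega>" "\<Omega> \<noteq> {}"
  shows "(\<Sum>x\<in>k ` \<Omega>. real (card {v \<in> \<Omega>. k v = x}) / real (card \<Omega>)) = 1"
proof -
  have "card \<Omega> = (\<Sum>x\<in>k ` \<Omega>. card {v \<in> \<Omega>. k v = x})"
    using sum.image_gen [OF assms(1), of "\<lambda>_. 1::nat" k] by simp
  then have "(\<Sum>x\<in>k ` \<Omega>. real (card {v \<in> \<Omega>. k v = x})) = real (card \<Omega>)"
    by (simp only: of_nat_sum)
  moreover have "real (card \<Omega>) \<noteq> 0" using assms by simp
  ultimately show ?thesis
    by (simp add: sum_divide_distrib [symmetric])
qed

lemma entropy_single_le_weights: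
  assumes "finite \<Omega>" "\<Omega> \<noteq> {}" and pos: "\<And>w. w \<in> \<Omega> \<Longrightarrow> W (X w i) > 0"
  shows "entropy X \<Omega> {i} \<le> (\<Sum>w\<in>\<Omega>. - ln (W (X w i))) / real (card \<Omega>) + sum W ((\<lambda>w. X w i) ` \<Omega>) - 1"
proof -
  let ?f = "\<lambda>w. real (card (fibre X \<Omega> {i} w))"
  have n: "real (card \<Omega>) > 0" using assms by (simp add: card_gt_0_iff)
  have "(\<Sum>w\<in>\<Omega>. ln (real (card \<Omega>) * W (X w i) / ?f w))
      = (\<Sum>w\<in>\<Omega>. ln (real (card \<Omega>) / ?f w) - (- ln (W (X w i))))"
  proof (rule sum.cong [OF refl])
    fix w assume w: "w \<in> \<Omega>"
    have "?f w > 0" using card_fibre_pos [OF assms(1) w] by simp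
    then have "real (card \<Omega>) / ?f w > 0" using n by simp
    from ln_mult_pos [OF this pos [OF w]]
    show "ln (real (card \<Omega>) * W (X w i) / ?f w) = ln (real (card \<Omega>) / ?f w) - (- ln (W (X w i)))"
      by simp
  qed
  moreover have "(\<Sum>w\<in>\<Omega>. ln (real (card \<Omega>) * W (X w i) / ?f w)) / real (card \<Omega>)
         \<le> sum W ((\<lambda>w. X w i) ` \<Omega>) - 1"
    using gibbs_inequality [where W = W and k = "\<lambda>w. X w i", OF assms] by (simp add: fibre_def)
  ultimately show ?thesis
    unfolding entropy_def by (simp only: sum_subtractf diff_divide_distrib)
qed

lemma entropy_single_le_ln:
  assumes "finite \<Omega>" "\<Omega> \<noteq> {}" "card ((\<lambda>w. X w i) ` \<Omega>) \<le> q"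
  shows "entropy X \<Omega> {i} \<le> ln (real q)"
proof -
  have "card ((\<lambda>w. X w i) ` \<Omega>) > 0" using assms(1,2) by (simp add: card_gt_0_iff)
  then have q: "real q > 0" using assms(3) by simp
  have "entropy X \<Omega> {i} \<le> (\<Sum>w\<in>\<Omega>. - ln (1 / real q)) / real (card \<Omega>)
       + (\<Sum>_\<in>(\<lambda>w. X w i) ` \<Omega>. 1 / real q) - 1"
    using entropy_single_le_weights [where W = "\<lambda>_. 1 / real q" and X = X and i = i, OF assms(1,2)] q by simp
  also have "\<dots> \<le> ln (real q)"
    using assms q by (simp add: ln_div divide_le_eq)
  finally show ?thesis .
qed

text \<open>Compare the law of the colour with the weight that is uniform on the frequent colours and gives
  \<open>\<epsilon>\<close> to each rare one.  There are at most \<open>q\<close> rare colours, of total probability at most \<open>q * \<epsilon>\<close>, so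
  giving them up costs little entropy when \<open>\<epsilon>\<close> is small.\<close>

lemma entropy_single_le_frequent:
  assumes "finite \<Omega>" "\<Omega> \<noteq> {}" "card ((\<lambda>w. X w i) ` \<Omega>) \<le> q"
    and "0 < \<epsilon>" "real q * \<epsilon> < 1"
  defines "C \<equiv> {c \<in> (\<lambda>w. X w i) ` \<Omega>. real (card {v \<in> \<Omega>. X v i = c}) \<ge> \<epsilon> * real (card \<Omega>)}"
  shows "C \<noteq> {}"
    and "entropy X \<Omega> {i} \<le> ln (real (card C)) + real q * (\<epsilon> * (1 + ln (1 / \<epsilon>)))"
proof -
  let ?k = "\<lambda>w. X w i" and ?n = "real (card \<Omega>)"
  let ?m = "\<lambda>c. real (card {v \<in> \<Omega>. X v i = c})"
  have n: "?n > 0" using assms(1,2) by (simp add: card_gt_0_iff)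
  have fin: "finite (?k ` \<Omega>)" using assms(1) by simp
  have "card (?k ` \<Omega>) > 0" using assms(1,2) by (simp add: card_gt_0_iff)
  then have q: "real q \<ge> 1" using assms(3) by simp
  have \<epsilon>1: "\<epsilon> < 1"
    using assms(4,5) mult_right_mono [OF q less_imp_le [OF assms(4)]] by linarith
  have C: "C \<subseteq> ?k ` \<Omega>" "finite C" using fin by (auto simp: C_def)
  have rare: "card (?k ` \<Omega> - C) \<le> q"
    using card_mono [OF fin, of "?k ` \<Omega> - C"] assms(3) by auto
  have total: "(\<Sum>c\<in>?k ` \<Omega>. ?m c / ?n) = 1"
    using sum_class_probabilities [OF assms(1,2), of ?k] .
  have rare_prob: "(\<Sum>c\<in>?k ` \<Omega> - C. ?m c / ?n) \<le> real q * \<epsilon>"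
  proof -
    have "(\<Sum>c\<in>?k ` \<Omega> - C. ?m c / ?n) \<le> (\<Sum>c\<in>?k ` \<Omega> - C. \<epsilon>)"
      using n by (intro sum_mono) (auto simp: C_def divide_le_eq)
    also have "\<dots> \<le> real q * \<epsilon>" using rare assms(4) by simp
    finally show ?thesis .
  qed
  show ne: "C \<noteq> {}"
    using total rare_prob assms(5) by auto
  then have s: "real (card C) \<ge> 1" using C(2) by (simp add: Suc_le_eq card_gt_0_iff)
  \<comment> \<open>Total weight at most \<open>1 + q * \<epsilon>\<close>, and \<open>- ln W\<close> is constant on \<open>C\<close> and on its complement.\<close>
  define W where "W = (\<lambda>c. if c \<in> C then 1 / real (card C) else \<epsilon>)"
  have split: "(\<Sum>c\<in>?k ` \<Omega>. h c) = (\<Sum>c\<in>C. h c) + (\<Sum>c\<in>?k ` \<Omega> - C. h c)" for h :: "_ \<Rightarrow> real"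
    using sum.subset_diff [OF C(1) fin, of h] by simp
  have sumW: "sum W (?k ` \<Omega>) - 1 \<le> real q * \<epsilon>"
  proof -
    have "sum W C = 1" using s by (simp add: W_def)
    moreover have "sum W (?k ` \<Omega> - C) = (\<Sum>c\<in>?k ` \<Omega> - C. \<epsilon>)"
      by (intro sum.cong) (auto simp: W_def)
    ultimately show ?thesis using split [of W] rare assms(4) by simp
  qed
  have "(\<Sum>w\<in>\<Omega>. - ln (W (?k w))) / ?n = (\<Sum>c\<in>?k ` \<Omega>. ?m c / ?n * - ln (W c))"
  proof -
    have "(\<Sum>w\<in>\<Omega>. - ln (W (?k w))) = (\<Sum>c\<in>?k ` \<Omega>. \<Sum>w | w \<in> \<Omega> \<and> ?k w = c. - ln (W (?k w)))"
      by (rule sum.image_gen [OF assms(1)])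
    also have "\<dots> = (\<Sum>c\<in>?k ` \<Omega>. ?m c * - ln (W c))" by simp
    finally show ?thesis by (simp add: sum_divide_distrib)
  qed
  also have "\<dots> = (\<Sum>c\<in>C. ?m c / ?n * ln (real (card C))) + (\<Sum>c\<in>?k ` \<Omega> - C. ?m c / ?n * ln (1 / \<epsilon>))"
    unfolding split using s assms(4) by (intro arg_cong2 [where f = "(+)"] sum.cong) (auto simp: W_def ln_div)
  also have "\<dots> = (\<Sum>c\<in>C. ?m c / ?n) * ln (real (card C)) + (\<Sum>c\<in>?k ` \<Omega> - C. ?m c / ?n) * ln (1 / \<epsilon>)"
    by (simp only: sum_distrib_right)
  also have "\<dots> \<le> 1 * ln (real (card C)) + (real q * \<epsilon>) * ln (1 / \<epsilon>)"
  proof (intro add_mono mult_right_mono rare_prob)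
    have "(\<Sum>c\<in>?k ` \<Omega> - C. ?m c / ?n) \<ge> 0" by (intro sum_nonneg) auto
    then show "(\<Sum>c\<in>C. ?m c / ?n) \<le> 1" using total split [of "\<lambda>c. ?m c / ?n"] by linarith
    show "0 \<le> ln (real (card C))" using s by simp
    show "0 \<le> ln (1 / \<epsilon>)" using assms(4) \<epsilon>1 by simp
  qed
  finally have A: "(\<Sum>w\<in>\<Omega>. - ln (W (?k w))) / ?n \<le> ln (real (card C)) + real q * \<epsilon> * ln (1 / \<epsilon>)" by simp
  have "W (X w i) > 0" for w using s assms(4) by (simp add: W_def)
  from entropy_single_le_weights [where W = W and X = X and i = i, OF assms(1,2) this] A sumW
  show "entropy X \<Omega> {i} \<le> ln (real (card C)) + real q * (\<epsilon> * (1 + ln (1 / \<epsilon>)))"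
    by (simp add: algebra_simps)
qed

text \<open>The Gibbs inequality with \<open>W\<close> the product of the two marginal laws, whose total mass is \<open>1\<close>.\<close>

lemma entropy_subadditive:
  assumes "finite \<Omega>"
  shows "entropy X \<Omega> (J \<union> K) \<le> entropy X \<Omega> J + entropy X \<Omega> K"
proof (cases "\<Omega> = {}")
  case True then show ?thesis by (simp add: entropy_def)
next
  case False
  let ?n = "real (card \<Omega>)"
  let ?J = "\<lambda>w. restrict (X w) J" and ?K = "\<lambda>w. restrict (X w) K"
  let ?p = "\<lambda>k x. real (card {v \<in> \<Omega>. k v = x}) / ?n"
  let ?k = "\<lambda>w. (?J w, ?K w)"
  define W where "W = (\<lambda>(x, y). ?p ?J x * ?p ?K y)"
  have n: "?n > 0" using assms False by (simp add: card_gt_0_iff)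
  have fib: "{v \<in> \<Omega>. ?k v = ?k w} = fibre X \<Omega> (J \<union> K) w" for w
    by (auto simp: fibre_def restrict_def fun_eq_iff; metis)
  have Wk: "W (?k w) = real (card (fibre X \<Omega> J w)) / ?n * (real (card (fibre X \<Omega> K w)) / ?n)" for w
    by (simp add: W_def fibre_restrict)
  have pos: "card (fibre X \<Omega> J' w) > 0" if "w \<in> \<Omega>" for J' w
    using card_fibre_pos [OF assms that] .
  have "sum W (?k ` \<Omega>) \<le> sum W (?J ` \<Omega> \<times> ?K ` \<Omega>)"
    using assms by (intro sum_mono2) (auto simp: W_def)
  also have "\<dots> = sum (?p ?J) (?J ` \<Omega>) * sum (?p ?K) (?K ` \<Omega>)"
    by (simp add: W_def sum.cartesian_product [symmetric] sum_product)
  also have "\<dots> = 1"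
    using sum_class_probabilities [OF assms False, of ?J] sum_class_probabilities [OF assms False, of ?K] by simp
  finally have "sum W (?k ` \<Omega>) - 1 \<le> 0" by simp
  moreover have "(\<Sum>w\<in>\<Omega>. ln (?n * W (?k w) / real (card {v \<in> \<Omega>. ?k v = ?k w}))) / ?n
         \<le> sum W (?k ` \<Omega>) - 1"
    by (rule gibbs_inequality [OF assms False]) (use pos n in \<open>auto simp: Wk\<close>)
  moreover have "(\<Sum>w\<in>\<Omega>. ln (?n * W (?k w) / real (card {v \<in> \<Omega>. ?k v = ?k w})))
     = (\<Sum>w\<in>\<Omega>. ln (?n / real (card (fibre X \<Omega> (J \<union> K) w))) - ln (?n / real (card (fibre X \<Omega> J w)))
          - ln (?n / real (card (fibre X \<Omega> K w))))"
    unfolding fib Wk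
    by (intro sum.cong refl) (use n pos in \<open>simp add: ln_div ln_mult\<close>)
  ultimately show ?thesis
    by (simp add: entropy_def sum_subtractf diff_divide_distrib)
qed

text \<open>The entropies of the fibres of \<open>G\<close> average to the conditional entropy given the colours in \<open>G\<close>.
  Swapping the double sum works because membership in a common fibre is symmetric.\<close>

lemma entropy_chain_rule:
  assumes "finite \<Omega>" "\<Omega> \<noteq> {}"
  shows "(\<Sum>f\<in>\<Omega>. entropy X (fibre X \<Omega> G f) J) = real (card \<Omega>) * (entropy X \<Omega> (G \<union> J) - entropy X \<Omega> G)"
proof -
  let ?F = "\<lambda>J w. real (card (fibre X \<Omega> J w))"
  have n: "real (card \<Omega>) > 0" using assms by (simp add: card_gt_0_iff)
  have "(\<Sum>f\<in>\<Omega>. entropy X (fibre X \<Omega> G f) J)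
     = (\<Sum>f\<in>\<Omega>. \<Sum>w\<in>{w \<in> \<Omega>. w \<in> fibre X \<Omega> G f}. ln (?F G w / ?F (G \<union> J) w) / ?F G w)"
  proof (rule sum.cong [OF refl])
    fix f assume f: "f \<in> \<Omega>"
    show "entropy X (fibre X \<Omega> G f) J
       = (\<Sum>w\<in>{w \<in> \<Omega>. w \<in> fibre X \<Omega> G f}. ln (?F G w / ?F (G \<union> J) w) / ?F G w)"
      unfolding entropy_def sum_divide_distrib
      by (rule sum.cong) (auto simp: fibre_fibre fibre_eq dest: subsetD [OF fibre_subset])
  qed
  also have "\<dots> = (\<Sum>w\<in>\<Omega>. \<Sum>f\<in>{f \<in> \<Omega>. w \<in> fibre X \<Omega> G f}. ln (?F G w / ?F (G \<union> J) w) / ?F G w)"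
    by (rule sum.swap_restrict [OF assms(1) assms(1)])
  also have "\<dots> = (\<Sum>w\<in>\<Omega>. ln (real (card \<Omega>) / ?F (G \<union> J) w) - ln (real (card \<Omega>) / ?F G w))"
  proof (rule sum.cong [OF refl])
    fix w assume w: "w \<in> \<Omega>"
    have "{f \<in> \<Omega>. w \<in> fibre X \<Omega> G f} = fibre X \<Omega> G w"
      using w by (auto simp: fibre_def)
    moreover have "card (fibre X \<Omega> J' w) > 0" for J' by (rule card_fibre_pos [OF assms(1) w])
    ultimately show "(\<Sum>f\<in>{f \<in> \<Omega>. w \<in> fibre X \<Omega> G f}. ln (?F G w / ?F (G \<union> J) w) / ?F G w)
       = ln (real (card \<Omega>) / ?F (G \<union> J) w) - ln (real (card \<Omega>) / ?F G w)"
      using n by (simp add: ln_div)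
  qed
  also have "\<dots> = real (card \<Omega>) * (entropy X \<Omega> (G \<union> J) - entropy X \<Omega> G)"
    using n by (simp add: entropy_def sum_subtractf right_diff_distrib)
  finally show ?thesis .
qed

text \<open>Subadditivity inside each fibre of \<open>G\<close>, averaged by the chain rule.\<close>

lemma entropy_submodular:
  assumes "finite \<Omega>"
  shows "entropy X \<Omega> (G \<union> J \<union> K) + entropy X \<Omega> G \<le> entropy X \<Omega> (G \<union> J) + entropy X \<Omega> (G \<union> K)"
proof (cases "\<Omega> = {}")
  case True then show ?thesis by (simp add: entropy_def)
next
  case False
  have n: "real (card \<Omega>) > 0" using assms False by (simp add: card_gt_0_iff)
  have "(\<Sum>f\<in>\<Omega>. entropy X (fibre X \<Omega> G f) (J \<union> K))
      \<le> (\<Sum>f\<in>\<Omega>. entropy X (fibre X \<Omega> G f) J) + (\<Sum>f\<in>\<Omega>. entropy X (fibre X \<Omega> G f) K)"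
    unfolding sum.distrib [symmetric]
    by (intro sum_mono entropy_subadditive finite_fibre assms)
  then have "real (card \<Omega>) * (entropy X \<Omega> (G \<union> (J \<union> K)) - entropy X \<Omega> G)
     \<le> real (card \<Omega>) * ((entropy X \<Omega> (G \<union> J) - entropy X \<Omega> G) + (entropy X \<Omega> (G \<union> K) - entropy X \<Omega> G))"
    unfolding entropy_chain_rule [OF assms False] by (simp add: algebra_simps)
  then have "(entropy X \<Omega> (G \<union> (J \<union> K)) - entropy X \<Omega> G)
     \<le> ((entropy X \<Omega> (G \<union> J) - entropy X \<Omega> G) + (entropy X \<Omega> (G \<union> K) - entropy X \<Omega> G))"
    using n mult_le_cancel_left_pos by blast
  then show ?thesis by (simp add: Un_assoc)
qed

lemma entropy_mono:
  assumes "finite \<Omega>" "J \<subseteq> K"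
  shows "entropy X \<Omega> J \<le> entropy X \<Omega> K"
  unfolding entropy_def
proof (intro divide_right_mono sum_mono)
  fix w assume w: "w \<in> \<Omega>"
  have pos: "card (fibre X \<Omega> J' w) > 0" for J' by (rule card_fibre_pos [OF assms(1) w])
  have "card (fibre X \<Omega> K w) \<le> card (fibre X \<Omega> J w)"
    using assms by (intro card_mono finite_fibre) (auto simp: fibre_def)
  moreover have "card \<Omega> > 0" using assms(1) w by (auto simp: card_gt_0_iff)
  ultimately show "ln (real (card \<Omega>) / real (card (fibre X \<Omega> J w)))
     \<le> ln (real (card \<Omega>) / real (card (fibre X \<Omega> K w)))"
    using pos [of J] pos [of K] by (simp add: divide_left_mono)
qed simp

lemma entropy_determined:
  assumes "finite \<Omega>" "\<Omega> \<noteq> {}" and "\<And>v w. v \<in> \<Omega> \<Longrightarrow> w \<in> \<Omega> \<Longrightarrow> (\<forall>i\<in>J. X v i = X w i) \<Longrightarrow> v = w"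
  shows "entropy X \<Omega> J = ln (real (card \<Omega>))"
proof -
  have "fibre X \<Omega> J w = {w}" if "w \<in> \<Omega>" for w
    using that assms(3) [of _ w] by (auto simp: fibre_def)
  then show ?thesis using assms(1,2) by (simp add: entropy_def)
qed

text \<open>Only the partition of \<open>\<Omega>\<close> into fibres matters, so \<open>\<Phi>\<close> may alter the colours themselves.  This is
  needed for renamings: a diagram on \<open>\<pi> ` A\<close> mentions other constants than one on \<open>A\<close>.\<close>

lemma entropy_invariant:
  assumes "bij_betw \<Phi> \<Omega> \<Omega>"
    and "\<And>v w. v \<in> \<Omega> \<Longrightarrow> w \<in> \<Omega> \<Longrightarrow> (\<forall>i\<in>K. X (\<Phi> v) i = X (\<Phi> w) i) \<longleftrightarrow> (\<forall>i\<in>J. X v i = X w i)"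
  shows "entropy X \<Omega> K = entropy X \<Omega> J"
proof -
  have "(\<Sum>w\<in>\<Omega>. ln (real (card \<Omega>) / real (card (fibre X \<Omega> K w))))
      = (\<Sum>w\<in>\<Omega>. ln (real (card \<Omega>) / real (card (fibre X \<Omega> K (\<Phi> w)))))"
    using sum.reindex_bij_betw [OF assms(1), of "\<lambda>w. ln (real (card \<Omega>) / real (card (fibre X \<Omega> K w)))"] by simp
  also have "\<dots> = (\<Sum>w\<in>\<Omega>. ln (real (card \<Omega>) / real (card (fibre X \<Omega> J w))))"
  proof (rule sum.cong [OF refl])
    fix w assume w: "w \<in> \<Omega>"
    have "\<Phi> ` fibre X \<Omega> J w = fibre X \<Omega> K (\<Phi> w)"
    proof (intro equalityI subsetI)
      fix v assume "v \<in> \<Phi> ` fibre X \<Omega> J w"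
      then show "v \<in> fibre X \<Omega> K (\<Phi> w)"
        using assms w bij_betw_apply [OF assms(1)] by (auto simp: fibre_def)
    next
      fix v assume v: "v \<in> fibre X \<Omega> K (\<Phi> w)"
      then obtain u where "u \<in> \<Omega>" "v = \<Phi> u"
        using assms(1) by (auto simp: fibre_def bij_betw_def)
      then show "v \<in> \<Phi> ` fibre X \<Omega> J w"
        using v w assms(2) [of u w] by (auto simp: fibre_def)
    qed
    moreover have "inj_on \<Phi> (fibre X \<Omega> J w)"
      by (rule inj_on_subset [OF bij_betw_imp_inj_on [OF assms(1)] fibre_subset])
    ultimately show "ln (real (card \<Omega>) / real (card (fibre X \<Omega> K (\<Phi> w))))
       = ln (real (card \<Omega>) / real (card (fibre X \<Omega> J w)))"
      by (metis card_image)
  qed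
  finally show ?thesis by (simp add: entropy_def)
qed

text \<open>The excess of the sum of the single entropies over the joint entropy is the relative entropy of
  the joint law with respect to the product of the marginals; by the Gibbs inequality it is at least
  the product mass of the combinations that are never attained.\<close>

lemma entropy_excess_ge_missing:
  assumes "finite \<Omega>" "\<Omega> \<noteq> {}" "finite J"
  shows "(\<Sum>i\<in>J. entropy X \<Omega> {i}) - entropy X \<Omega> J
    \<ge> (\<Sum>x \<in> (\<Pi>\<^sub>E i\<in>J. (\<lambda>w. X w i) ` \<Omega>) - (\<lambda>w. restrict (X w) J) ` \<Omega>.
         \<Prod>i\<in>J. real (card {v \<in> \<Omega>. X v i = x i}) / real (card \<Omega>))"
proof -
  let ?n = "real (card \<Omega>)"
  let ?k = "\<lambda>w. restrict (X w) J"
  let ?P = "\<Pi>\<^sub>E i\<in>J. (\<lambda>w. X w i) ` \<Omega>"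
  define W where "W = (\<lambda>x. \<Prod>i\<in>J. real (card {v \<in> \<Omega>. X v i = x i}) / ?n)"
  have n: "?n > 0" using assms by (simp add: card_gt_0_iff)
  have pos: "card (fibre X \<Omega> J' w) > 0" if "w \<in> \<Omega>" for J' w
    by (rule card_fibre_pos [OF assms(1) that])
  have Wk: "W (?k w) = (\<Prod>i\<in>J. real (card (fibre X \<Omega> {i} w)) / ?n)" for w
    by (simp add: W_def fibre_def)
  have "sum W ?P = (\<Prod>i\<in>J. \<Sum>c\<in>(\<lambda>w. X w i) ` \<Omega>. real (card {v \<in> \<Omega>. X v i = c}) / ?n)"
    unfolding W_def using assms by (subst prod_sum_PiE) auto
  also have "\<dots> = 1"
    by (intro prod.neutral ballI) (rule sum_class_probabilities [OF assms(1,2)])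
  finally have "sum W ?P = 1" .
  moreover have "finite ?P" using assms by (intro finite_PiE) auto
  moreover have "?k ` \<Omega> \<subseteq> ?P" by auto
  ultimately have diff: "sum W (?P - ?k ` \<Omega>) = 1 - sum W (?k ` \<Omega>)"
    by (simp add: sum_diff)
  have "(\<Sum>w\<in>\<Omega>. ln (?n * W (?k w) / real (card {v \<in> \<Omega>. ?k v = ?k w}))) / ?n
         \<le> sum W (?k ` \<Omega>) - 1"
    by (rule gibbs_inequality [OF assms(1,2)]) (unfold Wk, use pos n in \<open>auto intro!: prod_pos\<close>)
  moreover have "(\<Sum>w\<in>\<Omega>. ln (?n * W (?k w) / real (card {v \<in> \<Omega>. ?k v = ?k w})))
     = (\<Sum>w\<in>\<Omega>. ln (?n / real (card (fibre X \<Omega> J w))) - (\<Sum>i\<in>J. ln (?n / real (card (fibre X \<Omega> {i} w)))))"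
  proof (rule sum.cong [OF refl])
    fix w assume w: "w \<in> \<Omega>"
    have "ln (W (?k w)) = (\<Sum>i\<in>J. ln (real (card (fibre X \<Omega> {i} w)) / ?n))"
      unfolding Wk using pos [OF w] n assms(3) by (subst ln_prod) (simp_all add: less_imp_neq[symmetric])
    also have "\<dots> = - (\<Sum>i\<in>J. ln (?n / real (card (fibre X \<Omega> {i} w))))"
      unfolding sum_negf [symmetric] using pos [OF w] n by (intro sum.cong) (auto simp: ln_div)
    finally have l: "ln (W (?k w)) = - (\<Sum>i\<in>J. ln (?n / real (card (fibre X \<Omega> {i} w))))" .
    have "W (?k w) > 0" unfolding Wk using pos [OF w] n by (intro prod_pos) auto
    then have "ln (?n / real (card (fibre X \<Omega> J w)) * W (?k w))
       = ln (?n / real (card (fibre X \<Omega> J w))) + ln (W (?k w))"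
      using pos [OF w, of J] n by (intro ln_mult_pos) auto
    then show "ln (?n * W (?k w) / real (card {v \<in> \<Omega>. ?k v = ?k w}))
       = ln (?n / real (card (fibre X \<Omega> J w))) - (\<Sum>i\<in>J. ln (?n / real (card (fibre X \<Omega> {i} w))))"
      unfolding l by (simp add: fibre_restrict)
  qed
  moreover have "(\<Sum>i\<in>J. entropy X \<Omega> {i}) = (\<Sum>w\<in>\<Omega>. \<Sum>i\<in>J. ln (?n / real (card (fibre X \<Omega> {i} w)))) / ?n"
    unfolding entropy_def by (subst sum.swap) (simp add: sum_divide_distrib)
  ultimately have "(\<Sum>i\<in>J. entropy X \<Omega> {i}) - entropy X \<Omega> J \<ge> 1 - sum W (?k ` \<Omega>)"
    by (simp add: entropy_def sum_subtractf diff_divide_distrib)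
  then show ?thesis using diff by (simp add: W_def)
qed

text \<open>A combination of colours of frequency at least \<open>\<epsilon>\<close> has product mass at least \<open>\<epsilon> ^ card J\<close>, which is
  more than the excess allows to be missing.\<close>

lemma small_excess_imp_box:
  assumes "finite \<Omega>" "\<Omega> \<noteq> {}" "finite J" and "0 < \<epsilon>"
    and "(\<Sum>i\<in>J. entropy X \<Omega> {i}) - entropy X \<Omega> J < \<epsilon> ^ card J"
    and \<chi>: "\<And>i. i \<in> J \<Longrightarrow> \<chi> i \<in> (\<lambda>w. X w i) ` \<Omega> \<and> \<epsilon> * real (card \<Omega>) \<le> real (card {v \<in> \<Omega>. X v i = \<chi> i})"
  shows "\<exists>w\<in>\<Omega>. \<forall>i\<in>J. X w i = \<chi> i"
proof (rule ccontr)
  assume none: "\<not> ?thesis"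
  let ?n = "real (card \<Omega>)"
  let ?M = "(\<Pi>\<^sub>E i\<in>J. (\<lambda>w. X w i) ` \<Omega>) - (\<lambda>w. restrict (X w) J) ` \<Omega>"
  let ?W = "\<lambda>x. \<Prod>i\<in>J. real (card {v \<in> \<Omega>. X v i = x i}) / ?n"
  have n: "?n > 0" using assms by (simp add: card_gt_0_iff)
  have "restrict \<chi> J \<notin> (\<lambda>w. restrict (X w) J) ` \<Omega>"
  proof
    assume "restrict \<chi> J \<in> (\<lambda>w. restrict (X w) J) ` \<Omega>"
    then obtain w where "w \<in> \<Omega>" "restrict \<chi> J = restrict (X w) J" by auto
    then have "\<forall>i\<in>J. X w i = \<chi> i" by (metis restrict_apply')
    then show False using none \<open>w \<in> \<Omega>\<close> by auto
  qed
  then have mem: "restrict \<chi> J \<in> ?M" using \<chi> by auto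
  have "\<epsilon> ^ card J = (\<Prod>i\<in>J. \<epsilon>)" by simp
  also have "\<dots> \<le> ?W (restrict \<chi> J)"
    using n \<chi> assms(4) by (intro prod_mono) (auto simp: le_divide_eq)
  also have "\<dots> \<le> sum ?W ?M"
    using assms by (intro member_le_sum [OF mem] prod_nonneg finite_Diff finite_PiE) auto
  also have "\<dots> \<le> (\<Sum>i\<in>J. entropy X \<Omega> {i}) - entropy X \<Omega> J"
    by (rule entropy_excess_ge_missing [OF assms(1-3)])
  finally show False using assms(5) by simp
qed

section \<open>Symmetric submodular set functions\<close>

lemma ex_permutation_between_pairs:
  assumes "finite V" "A \<subseteq> S" "S \<subseteq> V" "A' \<subseteq> S'" "S' \<subseteq> V" "card A = card A'" "card S = card S'"
  shows "\<exists>\<pi>. \<pi> permutes V \<and> \<pi> ` A = A' \<and> \<pi> ` S = S'"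
proof -
  have fin: "finite S" "finite S'" "finite A" "finite A'"
    using assms finite_subset by metis+
  obtain f where f: "bij_betw f A A'"
    using finite_same_card_bij [OF fin(3,4) assms(6)] by blast
  have "card (S - A) = card (S' - A')"
    using assms fin by (simp add: card_Diff_subset)
  then obtain g where g: "bij_betw g (S - A) (S' - A')"
    using finite_same_card_bij fin by (metis finite_Diff)
  have "card (V - S) = card (V - S')"
    using assms fin by (simp add: card_Diff_subset)
  then obtain h where h: "bij_betw h (V - S) (V - S')"
    using finite_same_card_bij assms(1) by (metis finite_Diff)
  define \<pi> where "\<pi> = (\<lambda>x. if x \<in> A then f x else if x \<in> S then g x else if x \<in> V then h x else x)"
  have A: "bij_betw \<pi> A A'"
    using f by (subst bij_betw_cong [where g = f]) (auto simp: \<pi>_def)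
  have "bij_betw \<pi> (S - A) (S' - A')"
    using g by (subst bij_betw_cong [where g = g]) (auto simp: \<pi>_def)
  from bij_betw_combine [OF A this]
  have S: "bij_betw \<pi> S S'"
    using assms by (simp add: Un_absorb1)
  have "bij_betw \<pi> (V - S) (V - S')"
    using h assms by (subst bij_betw_cong [where g = h]) (auto simp: \<pi>_def)
  from bij_betw_combine [OF S this]
  have V: "bij_betw \<pi> V V"
    using assms by (simp add: Un_absorb1)
  have "\<pi> permutes V"
    using V assms by (intro bij_imp_permutes) (auto simp: \<pi>_def)
  then show ?thesis
    using A S by (auto simp: bij_betw_def)
qed

text \<open>For \<open>s \<le> n\<close> the left-hand side counts the \<open>r\<close>-subsets of an \<open>n\<close>-set that meet a fixed \<open>s\<close>-subset; each of the
  \<open>s\<close> points lies in a fraction \<open>r / n\<close> of all \<open>r\<close>-subsets.\<close>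

lemma binomial_shift_diff_le:
  assumes "n \<ge> 1" "r \<ge> 1"
  shows "real (n choose r) - real ((n - s) choose r) \<le> real s * (real r / real n * real (n choose r))"
proof -
  have eq: "real ((n - 1) choose (r - 1)) = real r / real n * real (n choose r)"
  proof -
    have "real (r * (n choose r)) = real (n * ((n - 1) choose (r - 1)))"
      using times_binomial_minus1_eq [of r n] assms by simp
    then show ?thesis using assms by (simp add: field_simps)
  qed
  have "real (n choose r) - real ((n - s) choose r) \<le> real s * real ((n - 1) choose (r - 1))"
  proof (induction s)
    case (Suc s)
    have "real ((n - s) choose r) - real ((n - Suc s) choose r) \<le> real ((n - 1) choose (r - 1))"
    proof (cases "n - s")
      case (Suc m)
      obtain r' where r': "r = Suc r'" using assms(2) by (cases r) auto
      have "m choose r' \<le> (n - 1) choose r'"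
        using Suc by (intro binomial_right_mono) auto
      moreover have "n - Suc s = m" using Suc by simp
      ultimately show ?thesis by (simp add: Suc r')
    next
      case 0
      then have "n - Suc s = 0" by simp
      then show ?thesis by (simp only: 0)
    qed
    then show ?case using Suc.IH by (simp add: algebra_simps)
  qed simp
  then show ?thesis by (simp only: eq)
qed

text \<open>The properties of \<open>E J\<close>, the entropy of the colours of a family \<open>J\<close> of \<open>r\<close>-subsets of \<open>V\<close>, from
  which near independence is derived; \<open>b\<close> is the most that a single \<open>r\<close>-set can contribute.\<close>

locale symmetric_submodular =
  fixes E :: "'v set set \<Rightarrow> real" and V :: "'v set" and r :: nat and b :: real
  assumes finite_V: "finite V"
    and submodular: "E (G \<union> J \<union> K) + E G \<le> E (G \<union> J) + E (G \<union> K)"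
    and mono: "J \<subseteq> K \<Longrightarrow> E J \<le> E K"
    and empty: "E {} = 0"
    and single_le: "A \<in> nsets V r \<Longrightarrow> E {A} \<le> b"
    and invariant: "\<pi> permutes V \<Longrightarrow> J \<subseteq> nsets V r \<Longrightarrow> E ((`) \<pi> ` J) = E J"
begin

definition gain :: "'v set set \<Rightarrow> 'v set \<Rightarrow> real" where
  "gain G A = E (insert A G) - E G"

text \<open>The information left in \<open>A\<close> when all other \<open>r\<close>-subsets of \<open>S\<close> are known.\<close>

definition top_gain :: "'v set \<Rightarrow> 'v set \<Rightarrow> real" where
  "top_gain S A = gain (nsets S r - {A}) A"

lemma gain_antimono: "G \<subseteq> K \<Longrightarrow> gain K A \<le> gain G A"
  using submodular [of G "{A}" K] by (simp add: gain_def Un_absorb1)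

lemma gain_nonneg: "gain G A \<ge> 0"
  using mono [of G "insert A G"] by (auto simp: gain_def)

lemma gain_le: "A \<in> nsets V r \<Longrightarrow> gain G A \<le> b"
  using gain_antimono [of "{}" G A] single_le [of A] by (simp add: gain_def empty)

lemma E_union_le:
  assumes "finite L" "\<And>A. A \<in> L \<Longrightarrow> gain K A \<le> x"
  shows "E (K \<union> L) \<le> E K + real (card L) * x"
  using assms
proof (induction L rule: finite_induct)
  case (insert A L)
  have "gain (K \<union> L) A \<le> x"
    using gain_antimono [of K "K \<union> L" A] insert.prems by fastforce
  then show ?case
    using insert by (simp add: gain_def algebra_simps)
qed simp

lemma E_union_ge:
  assumes "finite L" "L \<inter> K = {}" "\<And>A. A \<in> L \<Longrightarrow> gain (K \<union> L - {A}) A \<ge> x"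
  shows "E (K \<union> L) \<ge> E K + real (card L) * x"
proof -
  have "L' \<subseteq> L \<Longrightarrow> E (K \<union> L') \<ge> E K + real (card L') * x" if "finite L'" for L'
    using that
  proof (induction L' rule: finite_induct)
    case (insert A L')
    have "gain (K \<union> L - {A}) A \<le> gain (K \<union> L') A"
      using insert assms(2) by (intro gain_antimono) auto
    then have "x \<le> gain (K \<union> L') A"
      using assms(3) [of A] insert.prems by simp
    then show ?case
      using insert by (simp add: gain_def algebra_simps)
  qed simp
  then show ?thesis using assms(1) by blast
qed

text \<open>By symmetry only the size of \<open>S\<close> matters: a permutation of \<open>V\<close> carries one pair to the other.\<close>

lemma top_gain_invariant:
  assumes "A \<in> nsets S r" "S \<subseteq> V" "A' \<in> nsets S' r" "S' \<subseteq> V" "card S = card S'"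
  shows "top_gain S A = top_gain S' A'"
proof -
  obtain \<pi> where \<pi>: "\<pi> permutes V" "\<pi> ` A = A'" "\<pi> ` S = S'"
    using ex_permutation_between_pairs [OF finite_V, of A S A' S'] assms by (auto simp: nsets_def)
  have inj: "inj \<pi>" using \<pi>(1) by (rule permutes_inj)
  then have inj': "inj ((`) \<pi>)" by (simp add: inj_image_eq_iff inj_def)
  have sub: "nsets S r \<subseteq> nsets V r" using assms(2) by (rule nsets_mono)
  have nsets: "(`) \<pi> ` nsets S r = nsets S' r"
    using nset_image_obtains bij_betw_nsets [of \<pi> S S' r] inj \<pi>(3)
    by (simp add: bij_betw_def inj_on_subset [OF inj])
  have "(`) \<pi> ` (nsets S r - {A}) = nsets S' r - {A'}"
    using nsets \<pi>(2) by (simp add: image_set_diff [OF inj'])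
  moreover have "(`) \<pi> ` insert A (nsets S r - {A}) = insert A' (nsets S' r - {A'})"
    using nsets \<pi>(2) assms(1,3) by (simp add: insert_absorb)
  moreover have "E ((`) \<pi> ` (nsets S r - {A})) = E (nsets S r - {A})"
    using sub by (intro invariant \<pi>(1)) auto
  moreover have "E ((`) \<pi> ` insert A (nsets S r - {A})) = E (insert A (nsets S r - {A}))"
    using sub assms(1) by (intro invariant \<pi>(1)) auto
  ultimately show ?thesis
    by (simp add: top_gain_def gain_def)
qed

text \<open>Split off a set \<open>T\<close> of \<open>card S - r\<close> vertices.  The \<open>r\<close>-sets meeting \<open>T\<close> are few and contribute at most
  \<open>b\<close> each.  Once they are known, an \<open>r\<close>-set \<open>A\<close> disjoint from \<open>T\<close> contributes at most its gain on top of
  the other \<open>r\<close>-subsets of \<open>A \<union> T\<close>, since every one of those meets \<open>T\<close>; and \<open>A \<union> T\<close> has the size of \<open>S\<close>.\<close>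

lemma E_all_le_top_gain:
  assumes "A0 \<in> nsets S r" "S \<subseteq> V"
  shows "E (nsets V r) \<le> b * (real (card V choose r) - real ((card V - (card S - r)) choose r))
           + real (card V choose r) * top_gain S A0"
proof -
  define T where "T = S - A0"
  define I where "I = nsets V r - nsets (V - T) r"
  have A0: "A0 \<subseteq> S" "finite A0" "card A0 = r" using assms(1) by (auto simp: nsets_def)
  have finS: "finite S" using finite_V assms(2) finite_subset by blast
  have T: "T \<subseteq> V" "finite T" "card T = card S - r"
    using assms finS A0 by (auto simp: T_def card_Diff_subset)
  have sub: "nsets (V - T) r \<subseteq> nsets V r" by (rule nsets_mono) auto
  have fin: "finite (nsets V r)" by (rule finite_imp_finite_nsets [OF finite_V])
  have cardVT: "card (nsets (V - T) r) = (card V - (card S - r)) choose r"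
    using T finite_V by (simp add: card_Diff_subset)
  have cardI: "real (card I) = real (card V choose r) - real ((card V - (card S - r)) choose r)"
    using card_mono [OF fin sub] cardVT
    unfolding I_def by (subst card_Diff_subset) (use sub finite_subset [OF sub fin] finite_V in auto)
  have "E ({} \<union> I) \<le> E {} + real (card I) * b"
    using fin by (intro E_union_le gain_le) (auto simp: I_def)
  then have EI: "E I \<le> b * real (card I)" by (simp add: empty mult.commute)
  have "gain I A \<le> top_gain S A0" if A: "A \<in> nsets (V - T) r" for A
  proof -
    have A': "A \<subseteq> V" "A \<inter> T = {}" "finite A" "card A = r" using A by (auto simp: nsets_def)
    have "nsets (A \<union> T) r - {A} \<subseteq> I"
    proof
      fix B assume B: "B \<in> nsets (A \<union> T) r - {A}"
      then have B': "B \<subseteq> A \<union> T" "finite B" "card B = r" "B \<noteq> A" by (auto simp: nsets_def)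
      have "\<not> B \<subseteq> A" using B'(3,4) A'(3,4) card_subset_eq [of A B] by auto
      then have "B \<inter> T \<noteq> {}" using B' by blast
      then show "B \<in> I" using B' A' T by (auto simp: I_def nsets_def)
    qed
    then have "gain I A \<le> top_gain (A \<union> T) A"
      unfolding top_gain_def by (rule gain_antimono)
    also have "top_gain (A \<union> T) A = top_gain S A0"
    proof (rule top_gain_invariant)
      show "card (A \<union> T) = card S"
        using A' T card_mono [OF finS A0(1)] A0 by (simp add: card_Un_disjoint)
    qed (use A' T assms in \<open>auto simp: nsets_def\<close>)
    finally show ?thesis .
  qed
  then have "E (I \<union> nsets (V - T) r) \<le> E I + real (card (nsets (V - T) r)) * top_gain S A0"
    using fin sub finite_subset by (intro E_union_le) blast+
  moreover have "I \<union> nsets (V - T) r = nsets V r" using sub by (auto simp: I_def)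
  moreover have "real (card (nsets (V - T) r)) * top_gain S A0 \<le> real (card V choose r) * top_gain S A0"
    using card_mono [OF fin sub] finite_V
    by (intro mult_right_mono) (auto simp: top_gain_def gain_nonneg)
  ultimately show ?thesis using EI unfolding cardI by simp
qed

text \<open>Write \<open>u j\<close> for the top gain in sets of size \<open>r + j * (k - r)\<close>.  These numbers lie
  between \<open>0\<close> and \<open>b\<close>, so one of the first \<open>p\<close> steps down is at most \<open>b / p\<close>.  Let \<open>T\<close> consist of \<open>j * (k - r)\<close> vertices
  outside \<open>U\<close> and \<open>G\<close> of the \<open>r\<close>-subsets of \<open>U \<union> T\<close> that are not inside \<open>U\<close>.  Since \<open>G\<close> contains the
  other \<open>r\<close>-subsets of \<open>A \<union> T\<close>, the gain of \<open>A\<close> over \<open>G\<close> is at most \<open>u j\<close>; since \<open>U \<union> T\<close> has size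
  \<open>r + (j + 1) * (k - r)\<close>, all gains inside it are at least \<open>u (j + 1)\<close>, which is the number \<open>h\<close>.\<close>

lemma nearly_independent_sample:
  assumes "U \<subseteq> V" "card U = k" "r \<le> k" "p > 0" "k + p * (k - r) \<le> card V"
  shows "\<exists>G h. 0 \<le> h
    \<and> (\<forall>A\<in>nsets U r. h \<le> gain G A \<and> gain G A \<le> h + b / real p)
    \<and> real (card (nsets U r)) * h \<le> E (G \<union> nsets U r) - E G
    \<and> E (nsets V r) \<le> b * (real (card V choose r) - real ((card V - (k + p * (k - r))) choose r))
           + real (card V choose r) * h"
proof -
  have finU: "finite U" using assms(1) finite_V finite_subset by blast
  obtain A0 where A0: "A0 \<in> nsets U r"
    using assms(2,3) finU by (metis (no_types, lifting) nsets_eq_empty_iff equals0I linorder_not_le)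
  then have A0': "A0 \<subseteq> U" "finite A0" "card A0 = r" by (auto simp: nsets_def)
  have b: "b \<ge> 0"
    using single_le [of A0] mono [of "{}" "{A0}"] empty A0 nsets_mono [OF assms(1), of r] by auto
  have "card (V - U) \<ge> p * (k - r)"
    using assms finU by (simp add: card_Diff_subset)
  have ex: "\<exists>T. T \<subseteq> V - U \<and> card T = t" if "t \<le> p * (k - r)" for t
    using \<open>card (V - U) \<ge> p * (k - r)\<close> that obtain_subset_with_card_n [of t "V - U"] by (metis order_trans)
  define T where "T = (\<lambda>j. SOME T. T \<subseteq> V - U \<and> card T = j * (k - r))"
  have T: "T j \<subseteq> V - U" "card (T j) = j * (k - r)" if "j \<le> p" for j
    using someI_ex [OF ex [of "j * (k - r)"]] that by (auto simp: T_def)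
  \<comment> \<open>If every one of the first \<open>p\<close> steps exceeded \<open>b / p\<close>, they would telescope to more than \<open>b\<close>.\<close>
  define u where "u = (\<lambda>j. top_gain (A0 \<union> T j) A0)"
  have u_bounds: "0 \<le> u j" "u j \<le> b" for j
    using gain_nonneg gain_le A0 nsets_mono [OF assms(1), of r] by (auto simp: u_def top_gain_def)
  have "\<exists>j<p. u j - u (Suc j) \<le> b / real p"
  proof (rule ccontr)
    assume "\<not> ?thesis"
    then have "(\<Sum>j<p. b / real p) < (\<Sum>j<p. u j - u (Suc j))"
      using assms(4) by (intro sum_strict_mono) auto
    also have "\<dots> = u 0 - u p" by (rule sum_lessThan_telescope')
    also have "\<dots> \<le> b" using u_bounds [of 0] u_bounds [of p] by linarith
    finally show False using assms(4) by simp
  qed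
  then obtain j where j: "j < p" "u j - u (Suc j) \<le> b / real p" by blast
  note Tj = T [OF less_imp_le [OF j(1)]]
  have finT: "finite (T j)" using Tj(1) finite_V by (meson finite_Diff finite_subset)
  define S where "S = U \<union> T j"
  have SV: "S \<subseteq> V" using Tj assms(1) by (auto simp: S_def)
  have cardS: "card S = k + j * (k - r)"
    unfolding S_def using Tj finT finU assms(2) by (subst card_Un_disjoint) auto
  have T': "T (Suc j) \<subseteq> V - U" "card (T (Suc j)) = Suc j * (k - r)" using T [of "Suc j"] j(1) by auto
  have finT': "finite (T (Suc j))" using T'(1) finite_V by (meson finite_Diff finite_subset)
  have cardS': "card (A0 \<union> T (Suc j)) = card S"
  proof -
    have "card (A0 \<union> T (Suc j)) = r + Suc j * (k - r)"
      using T' finT' A0' by (subst card_Un_disjoint) auto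
    then show ?thesis using cardS assms(3) by simp
  qed
  define h where "h = u (Suc j)"
  have h: "top_gain S A = h" if "A \<in> nsets S r" for A
    unfolding h_def u_def
    using that SV A0' A0 T' assms(1) cardS' by (intro top_gain_invariant) (auto simp: nsets_def)
  define G where "G = nsets S r - nsets U r"
  have nU: "nsets U r \<subseteq> nsets S r" by (rule nsets_mono) (simp add: S_def)
  have finN: "finite (nsets U r)" by (rule finite_imp_finite_nsets [OF finU])
  have GU: "G \<union> nsets U r = nsets S r" using nU by (auto simp: G_def)
  have low: "h \<le> gain G A" if "A \<in> nsets U r" for A
  proof -
    have "h = top_gain S A" using h that nU by auto
    also have "\<dots> \<le> gain G A"
      unfolding top_gain_def using that by (intro gain_antimono) (auto simp: G_def)
    finally show ?thesis .
  qed
  have up: "gain G A \<le> h + b / real p" if A: "A \<in> nsets U r" for A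
  proof -
    have A': "A \<subseteq> U" "finite A" "card A = r" using A by (auto simp: nsets_def)
    have "nsets (A \<union> T j) r - {A} \<subseteq> G"
    proof
      fix B assume B: "B \<in> nsets (A \<union> T j) r - {A}"
      then have B': "B \<subseteq> A \<union> T j" "finite B" "card B = r" "B \<noteq> A" by (auto simp: nsets_def)
      have "\<not> B \<subseteq> A" using B'(3,4) A'(2,3) card_subset_eq [of A B] by auto
      then have "\<not> B \<subseteq> U" using B' Tj(1) by blast
      then show "B \<in> G" using B' A' by (auto simp: G_def nsets_def S_def)
    qed
    then have "gain G A \<le> top_gain (A \<union> T j) A"
      unfolding top_gain_def by (rule gain_antimono)
    also have "\<dots> = u j"
      unfolding u_def
    proof (rule top_gain_invariant)
      show "card (A \<union> T j) = card (A0 \<union> T j)"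
        using A' A0' Tj finT by (subst (1 2) card_Un_disjoint) auto
    qed (use A' A0' Tj assms(1) in \<open>auto simp: nsets_def\<close>)
    finally show ?thesis using j(2) by (simp add: h_def)
  qed
  have joint: "real (card (nsets U r)) * h \<le> E (G \<union> nsets U r) - E G"
  proof -
    have "gain (G \<union> nsets U r - {A}) A \<ge> h" if "A \<in> nsets U r" for A
      using h [of A] that nU unfolding GU by (auto simp: top_gain_def)
    then have "E G + real (card (nsets U r)) * h \<le> E (G \<union> nsets U r)"
      by (intro E_union_ge finN) (auto simp: G_def)
    then show ?thesis by simp
  qed
  have total: "E (nsets V r) \<le> b * (real (card V choose r) - real ((card V - (k + p * (k - r))) choose r))
           + real (card V choose r) * h"
  proof -
    have A0S: "A0 \<in> nsets S r" using A0 nU by auto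
    have "card S - r \<le> k + p * (k - r)"
      using j(1) by (simp add: cardS le_diff_conv trans_le_add1)
    then have "(card V - (k + p * (k - r))) choose r \<le> (card V - (card S - r)) choose r"
      by (intro binomial_right_mono) auto
    then have "b * (real (card V choose r) - real ((card V - (card S - r)) choose r))
      \<le> b * (real (card V choose r) - real ((card V - (k + p * (k - r))) choose r))"
      using b by (intro mult_left_mono) auto
    then show ?thesis
      using E_all_le_top_gain [OF A0S SV] h [OF A0S] by simp
  qed
  show ?thesis
    using u_bounds [of "Suc j"] low up joint total unfolding h_def [symmetric] by blast
qed

end

section \<open>Boxes of freely combinable colours\<close>

text \<open>Revealing the colours in the family \<open>G\<close> of the near-independence lemma means passing to a fibre of
  \<open>G\<close>.  On average over the fibres the single entropies are large and their excess over the joint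
  entropy is small.  To obtain both in one fibre, maximise the former minus \<open>\<kappa>\<close> times the latter:
  as the single entropies are bounded by \<open>ln q\<close>, a large penalty \<open>\<kappa>\<close> forces the excess below the
  threshold at which all combinations of frequent colours occur.\<close>

lemma rich_box:
  fixes X :: "'w \<Rightarrow> 'v set \<Rightarrow> 'c"
  assumes sym: "symmetric_submodular (entropy X \<Omega>) V r (ln (real q))"
    and \<Omega>: "finite \<Omega>" "\<Omega> \<noteq> {}" and det: "entropy X \<Omega> (nsets V r) = ln (real (card \<Omega>))"
    and colours: "\<And>A. A \<in> nsets V r \<Longrightarrow> card ((\<lambda>w. X w A) ` \<Omega>) \<le> q"
    and U: "U \<subseteq> V" "card U = k" "r \<le> k" and p: "p > 0" "k + p * (k - r) \<le> card V"
    and \<epsilon>: "0 < \<epsilon>" "real q * \<epsilon> < 1" and lam: "\<kappa> > 0" and q: "q \<ge> 1"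
    and small: "real (k choose r) * ln (real q) / \<kappa> + real (k choose r) * ln (real q) / real p < \<epsilon> ^ (k choose r)"
  shows "\<exists>Ch h. (\<forall>A\<in>nsets U r. Ch A \<noteq> {} \<and> Ch A \<subseteq> (\<lambda>w. X w A) ` \<Omega>)
    \<and> (\<forall>\<chi>. (\<forall>A\<in>nsets U r. \<chi> A \<in> Ch A) \<longrightarrow> (\<exists>w\<in>\<Omega>. \<forall>A\<in>nsets U r. X w A = \<chi> A))
    \<and> real (k choose r) * (h - \<kappa> * ln (real q) / real p - real q * (\<epsilon> * (1 + ln (1 / \<epsilon>))))
        \<le> (\<Sum>A\<in>nsets U r. ln (real (card (Ch A))))
    \<and> ln (real (card \<Omega>)) \<le> ln (real q) * (real (card V choose r) - real ((card V - (k + p * (k - r))) choose r))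
        + real (card V choose r) * h"
proof -
  interpret symmetric_submodular "entropy X \<Omega>" V r "ln (real q)" by (rule sym)
  let ?N = "nsets U r" and ?K = "real (k choose r)" and ?b = "ln (real q)" and ?E = "entropy X \<Omega>"
  have finU: "finite U" using U(1) finite_V finite_subset by blast
  have finN: "finite ?N" by (rule finite_imp_finite_nsets [OF finU])
  have cardN: "card ?N = k choose r" using finU U(2) by simp
  have NV: "?N \<subseteq> nsets V r" by (rule nsets_mono [OF U(1)])
  obtain G h where h: "0 \<le> h" "\<And>A. A \<in> ?N \<Longrightarrow> h \<le> gain G A" "\<And>A. A \<in> ?N \<Longrightarrow> gain G A \<le> h + ?b / real p"
    and joint: "?K * h \<le> ?E (G \<union> ?N) - ?E G"
    and total: "?E (nsets V r) \<le> ?b * (real (card V choose r) - real ((card V - (k + p * (k - r))) choose r))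
           + real (card V choose r) * h"
    using nearly_independent_sample [OF U p] unfolding cardN by blast
  define F where "F = (\<lambda>f. fibre X \<Omega> G f)"
  define a where "a = (\<lambda>f. \<Sum>A\<in>?N. entropy X (F f) {A})"
  define D where "D = (\<lambda>f. a f - entropy X (F f) ?N)"
  have n: "real (card \<Omega>) > 0" using \<Omega> by (simp add: card_gt_0_iff)
  have F: "finite (F f)" "F f \<subseteq> \<Omega>" for f
    by (auto simp: F_def intro: finite_fibre [OF \<Omega>(1)] subsetD [OF fibre_subset])
  have Fne: "F f \<noteq> {}" if "f \<in> \<Omega>" for f using that by (auto simp: F_def fibre_def)
  have sum_a: "(\<Sum>f\<in>\<Omega>. a f) = real (card \<Omega>) * (\<Sum>A\<in>?N. gain G A)"
  proof -
    have "(\<Sum>f\<in>\<Omega>. a f) = (\<Sum>A\<in>?N. \<Sum>f\<in>\<Omega>. entropy X (F f) {A})"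
      unfolding a_def by (rule sum.swap)
    also have "\<dots> = (\<Sum>A\<in>?N. real (card \<Omega>) * gain G A)"
      unfolding F_def entropy_chain_rule [OF \<Omega>] by (simp add: gain_def)
    finally show ?thesis by (simp add: sum_distrib_left)
  qed
  have sum_D: "(\<Sum>f\<in>\<Omega>. D f) = real (card \<Omega>) * ((\<Sum>A\<in>?N. gain G A) - (?E (G \<union> ?N) - ?E G))"
    unfolding D_def sum_subtractf sum_a unfolding F_def entropy_chain_rule [OF \<Omega>]
    by (simp add: right_diff_distrib)
  have low: "?K * h \<le> (\<Sum>A\<in>?N. gain G A)"
    using sum_mono [of ?N "\<lambda>_. h" "gain G"] h(2) cardN by simp
  have up: "(\<Sum>A\<in>?N. gain G A) \<le> ?K * (h + ?b / real p)"
    using sum_mono [of ?N "gain G" "\<lambda>_. h + ?b / real p"] h(3) cardN by simp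
  \<comment> \<open>The averages over all fibres; some fibre does at least as well.\<close>
  have "(\<Sum>f\<in>\<Omega>. ?K * (h - \<kappa> * ?b / real p)) \<le> (\<Sum>f\<in>\<Omega>. a f - \<kappa> * D f)"
  proof -
    have "(\<Sum>A\<in>?N. gain G A) - (?E (G \<union> ?N) - ?E G) \<le> ?K * (?b / real p)"
      using up joint by (simp add: algebra_simps)
    then have "\<kappa> * ((\<Sum>A\<in>?N. gain G A) - (?E (G \<union> ?N) - ?E G)) \<le> \<kappa> * (?K * (?b / real p))"
      using lam by (intro mult_left_mono) auto
    then have "?K * h - \<kappa> * (?K * (?b / real p))
       \<le> (\<Sum>A\<in>?N. gain G A) - \<kappa> * ((\<Sum>A\<in>?N. gain G A) - (?E (G \<union> ?N) - ?E G))"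
      using low by linarith
    then have "real (card \<Omega>) * (?K * h - \<kappa> * (?K * (?b / real p)))
       \<le> real (card \<Omega>) * ((\<Sum>A\<in>?N. gain G A) - \<kappa> * ((\<Sum>A\<in>?N. gain G A) - (?E (G \<union> ?N) - ?E G)))"
      using n by (intro mult_left_mono) auto
    then show ?thesis
      unfolding sum_subtractf sum_distrib_left [symmetric] sum_a sum_D
      by (simp add: algebra_simps)
  qed
  then obtain f where f: "f \<in> \<Omega>" "?K * (h - \<kappa> * ?b / real p) \<le> a f - \<kappa> * D f"
    using sum_strict_mono [OF \<Omega>, of "\<lambda>f. a f - \<kappa> * D f" "\<lambda>_. ?K * (h - \<kappa> * ?b / real p)"]
    by (meson linorder_not_le)
  have single: "card ((\<lambda>w. X w A) ` F f) \<le> q" if "A \<in> ?N" for A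
    using colours [of A] card_mono [of "(\<lambda>w. X w A) ` \<Omega>" "(\<lambda>w. X w A) ` F f"] that NV F \<Omega>(1)
    by (meson finite_imageI image_mono le_trans subsetD)
  have D0: "D f \<ge> 0"
    using entropy_excess_ge_missing [OF F(1) Fne [OF f(1)] finN, of X]
    unfolding D_def a_def
    by (smt (verit) sum_nonneg prod_nonneg divide_nonneg_nonneg of_nat_0_le_iff)
  have "a f \<le> (\<Sum>A\<in>?N. ?b)"
    unfolding a_def using single by (intro sum_mono entropy_single_le_ln F Fne f)
  then have "a f \<le> ?K * ?b" by (simp add: U(2))
  moreover have "?K * h \<ge> 0" using h(1) by simp
  ultimately have "\<kappa> * D f \<le> ?K * ?b + \<kappa> * (?K * ?b / real p)"
    using f(2) by (simp add: right_diff_distrib mult.left_commute)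
  then have "D f \<le> (?K * ?b + \<kappa> * (?K * ?b / real p)) / \<kappa>"
    using lam by (simp add: pos_le_divide_eq mult.commute)
  also have "\<dots> = ?K * ?b / \<kappa> + ?K * ?b / real p"
    using lam by (simp add: add_divide_distrib)
  finally have D: "D f < \<epsilon> ^ card ?N" using small by (simp add: U(2))
  define Ch where "Ch = (\<lambda>A. {c \<in> (\<lambda>w. X w A) ` F f. \<epsilon> * real (card (F f)) \<le> real (card {v \<in> F f. X v A = c})})"
  have Ch: "Ch A \<noteq> {}" "entropy X (F f) {A} \<le> ln (real (card (Ch A))) + real q * (\<epsilon> * (1 + ln (1 / \<epsilon>)))"
    if "A \<in> ?N" for A
    unfolding Ch_def using entropy_single_le_frequent [where X = X and i = A, OF F(1) Fne [OF f(1)] single [OF that] \<epsilon>] by auto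
  have realised: "\<exists>w\<in>\<Omega>. \<forall>A\<in>?N. X w A = \<chi> A" if "\<forall>A\<in>?N. \<chi> A \<in> Ch A" for \<chi>
  proof -
    have "\<exists>w\<in>F f. \<forall>A\<in>?N. X w A = \<chi> A"
      using D that by (intro small_excess_imp_box [OF F(1) Fne [OF f(1)] finN \<epsilon>(1)])
        (auto simp: D_def a_def Ch_def)
    then show ?thesis using F(2) by blast
  qed
  have large: "?K * (h - \<kappa> * ?b / real p - real q * (\<epsilon> * (1 + ln (1 / \<epsilon>)))) \<le> (\<Sum>A\<in>?N. ln (real (card (Ch A))))"
  proof -
    have "a f \<le> (\<Sum>A\<in>?N. ln (real (card (Ch A))) + real q * (\<epsilon> * (1 + ln (1 / \<epsilon>))))"
      unfolding a_def using Ch(2) by (intro sum_mono)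
    also have "\<dots> = (\<Sum>A\<in>?N. ln (real (card (Ch A)))) + ?K * (real q * (\<epsilon> * (1 + ln (1 / \<epsilon>))))"
      by (simp add: sum.distrib U(2))
    finally show ?thesis
      using f(2) mult_nonneg_nonneg [OF less_imp_le [OF lam] D0] by (simp add: right_diff_distrib)
  qed
  have "\<forall>A\<in>?N. Ch A \<noteq> {} \<and> Ch A \<subseteq> (\<lambda>w. X w A) ` \<Omega>"
    using F(2) Ch(1) by (auto simp: Ch_def)
  then show ?thesis
    using realised large total unfolding det by (intro exI [of _ Ch] exI [of _ h] conjI allI impI)
qed

text \<open>The constants are chosen in the order \<open>\<epsilon>\<close>, \<open>\<kappa>\<close>, \<open>p\<close>, \<open>n0\<close>: the frequency threshold, the penalty
  that beats \<open>\<epsilon> ^ binomial k r\<close>, the number of pigeonhole steps that makes even the penalised excess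
  small, and finally a size beyond which the \<open>r\<close>-sets meeting the auxiliary vertices are negligible.\<close>

lemma rich_box_exists:
  fixes q k r :: nat and \<delta> :: real
  assumes "\<delta> > 0" "1 \<le> r" "r \<le> k" "q \<ge> 1"
  shows "\<exists>n0. \<forall>(X :: 'w \<Rightarrow> 'v set \<Rightarrow> 'c) \<Omega> V U.
     symmetric_submodular (entropy X \<Omega>) V r (ln (real q)) \<longrightarrow> finite \<Omega> \<longrightarrow> \<Omega> \<noteq> {}
     \<longrightarrow> entropy X \<Omega> (nsets V r) = ln (real (card \<Omega>))
     \<longrightarrow> (\<forall>A\<in>nsets V r. card ((\<lambda>w. X w A) ` \<Omega>) \<le> q)
     \<longrightarrow> U \<subseteq> V \<longrightarrow> card U = k \<longrightarrow> n0 \<le> card V \<longrightarrow>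
     (\<exists>Ch. (\<forall>A\<in>nsets U r. Ch A \<noteq> {} \<and> Ch A \<subseteq> (\<lambda>w. X w A) ` \<Omega>)
       \<and> (\<forall>\<chi>. (\<forall>A\<in>nsets U r. \<chi> A \<in> Ch A) \<longrightarrow> (\<exists>w\<in>\<Omega>. \<forall>A\<in>nsets U r. X w A = \<chi> A))
       \<and> real (k choose r) * (ln (real (card \<Omega>)) / real (card V choose r) - \<delta>)
           \<le> (\<Sum>A\<in>nsets U r. ln (real (card (Ch A)))))"
proof -
  let ?K = "real (k choose r)" and ?b = "ln (real q)"
  have b: "?b \<ge> 0" using assms(4) by simp
  have "((\<lambda>\<epsilon>::real. real q * \<epsilon>) \<longlongrightarrow> 0) (at_right 0)"
    by real_asymp
  then have 1: "eventually (\<lambda>\<epsilon>. real q * \<epsilon> < 1) (at_right 0)"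
    by (rule order_tendstoD) simp
  have "((\<lambda>\<epsilon>::real. real q * (\<epsilon> * (1 + ln (1 / \<epsilon>)))) \<longlongrightarrow> 0) (at_right 0)"
    by real_asymp
  then have 2: "eventually (\<lambda>\<epsilon>. real q * (\<epsilon> * (1 + ln (1 / \<epsilon>))) < \<delta> / 3) (at_right 0)"
    using assms(1) by (intro order_tendstoD) auto
  have "eventually (\<lambda>\<epsilon>. 0 < \<epsilon> \<and> real q * \<epsilon> < 1 \<and> real q * (\<epsilon> * (1 + ln (1 / \<epsilon>))) < \<delta> / 3) (at_right 0)"
    using 1 2 eventually_at_right_less [of 0] by eventually_elim auto
  then obtain \<epsilon> where \<epsilon>: "0 < \<epsilon>" "real q * \<epsilon> < 1" "real q * (\<epsilon> * (1 + ln (1 / \<epsilon>))) < \<delta> / 3"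
    using eventually_happens' [OF trivial_limit_at_right_real] by blast
  have \<epsilon>K: "\<epsilon> ^ (k choose r) > 0" using \<epsilon>(1) by simp
  define \<kappa> where "\<kappa> = 2 * (?K * ?b + 1) / \<epsilon> ^ (k choose r)"
  have lam: "\<kappa> > 0" "?K * ?b / \<kappa> < \<epsilon> ^ (k choose r) / 2"
  proof -
    have Kb: "?K * ?b \<ge> 0" using b by simp
    then show l: "\<kappa> > 0" unfolding \<kappa>_def using \<epsilon>K by (intro divide_pos_pos mult_pos_pos) linarith+
    have "\<kappa> * (\<epsilon> ^ (k choose r) / 2) = ?K * ?b + 1"
      using \<epsilon>(1) by (simp add: \<kappa>_def)
    then show "?K * ?b / \<kappa> < \<epsilon> ^ (k choose r) / 2"
      using l by (simp only: pos_divide_less_eq mult.commute [of _ \<kappa>])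
  qed
  have "(\<lambda>p. ?K * ?b / real p) \<longlonglongrightarrow> 0"
    by real_asymp
  then have 1: "eventually (\<lambda>p. ?K * ?b / real p < \<epsilon> ^ (k choose r) / 2) sequentially"
    using \<epsilon>K by (intro order_tendstoD) auto
  have "(\<lambda>p. \<kappa> * ?b / real p) \<longlonglongrightarrow> 0"
    by real_asymp
  then have 2: "eventually (\<lambda>p. \<kappa> * ?b / real p < \<delta> / 3) sequentially"
    using assms(1) by (intro order_tendstoD) auto
  have "eventually (\<lambda>p. 0 < p \<and> ?K * ?b / real p < \<epsilon> ^ (k choose r) / 2 \<and> \<kappa> * ?b / real p < \<delta> / 3) sequentially"
    using 1 2 eventually_gt_at_top [of 0] by eventually_elim auto
  then obtain p where p: "0 < p" "?K * ?b / real p < \<epsilon> ^ (k choose r) / 2" "\<kappa> * ?b / real p < \<delta> / 3"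
    using eventually_happens' [OF sequentially_bot] by blast
  have small: "?K * ?b / \<kappa> + ?K * ?b / real p < \<epsilon> ^ (k choose r)" using lam(2) p(2) by linarith
  define s where "s = k + p * (k - r)"
  have "(\<lambda>n. ?b * (real s * (real r / real n))) \<longlonglongrightarrow> 0"
    by real_asymp
  then have "eventually (\<lambda>n. ?b * (real s * (real r / real n)) < \<delta> / 3) sequentially"
    using assms(1) by (intro order_tendstoD) auto
  then obtain n1 where n1: "\<And>n. n \<ge> n1 \<Longrightarrow> ?b * (real s * (real r / real n)) < \<delta> / 3"
    by (auto simp: eventually_sequentially)
  show ?thesis
  proof (rule exI [of _ "max n1 s"], intro allI impI)
    fix X :: "'w \<Rightarrow> 'v set \<Rightarrow> 'c" and \<Omega> V U
    assume sym: "symmetric_submodular (entropy X \<Omega>) V r ?b" and \<Omega>: "finite \<Omega>" "\<Omega> \<noteq> {}"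
      and det: "entropy X \<Omega> (nsets V r) = ln (real (card \<Omega>))"
      and colours: "\<forall>A\<in>nsets V r. card ((\<lambda>w. X w A) ` \<Omega>) \<le> q"
      and U: "U \<subseteq> V" "card U = k" and n: "max n1 s \<le> card V"
    let ?n = "card V"
    have ns: "k + p * (k - r) \<le> ?n" "n1 \<le> ?n" using n by (auto simp: s_def)
    have nr: "r \<le> ?n" using ns assms(3) by linarith
    have Cpos: "real (?n choose r) > 0" using nr by simp
    have cols: "\<And>A. A \<in> nsets V r \<Longrightarrow> card ((\<lambda>w. X w A) ` \<Omega>) \<le> q" using colours by blast
    obtain Ch h where Ch: "\<forall>A\<in>nsets U r. Ch A \<noteq> {} \<and> Ch A \<subseteq> (\<lambda>w. X w A) ` \<Omega>"
        "\<forall>\<chi>. (\<forall>A\<in>nsets U r. \<chi> A \<in> Ch A) \<longrightarrow> (\<exists>w\<in>\<Omega>. \<forall>A\<in>nsets U r. X w A = \<chi> A)"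
      and big: "?K * (h - \<kappa> * ?b / real p - real q * (\<epsilon> * (1 + ln (1 / \<epsilon>))))
        \<le> (\<Sum>A\<in>nsets U r. ln (real (card (Ch A))))"
      and total: "ln (real (card \<Omega>)) \<le> ?b * (real (?n choose r) - real ((?n - s) choose r)) + real (?n choose r) * h"
      using rich_box [OF sym \<Omega> det cols U assms(3) p(1) ns(1) \<epsilon>(1,2) lam(1) assms(4) small]
      unfolding s_def by blast
    have "?b * (real (?n choose r) - real ((?n - s) choose r))
        \<le> ?b * (real s * (real r / real ?n * real (?n choose r)))"
      using assms(2) nr b by (intro mult_left_mono binomial_shift_diff_le) auto
    also have "\<dots> = ?b * (real s * (real r / real ?n)) * real (?n choose r)" by simp
    also have "\<dots> \<le> \<delta> / 3 * real (?n choose r)"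
      using n1 [OF ns(2)] Cpos by (intro mult_right_mono) auto
    finally have "ln (real (card \<Omega>)) \<le> (\<delta> / 3 + h) * real (?n choose r)"
      using total by (simp add: algebra_simps)
    then have "ln (real (card \<Omega>)) / real (?n choose r) \<le> \<delta> / 3 + h"
      using Cpos by (simp add: pos_divide_le_eq)
    then have "ln (real (card \<Omega>)) / real (?n choose r) - \<delta>
       \<le> h - \<kappa> * ?b / real p - real q * (\<epsilon> * (1 + ln (1 / \<epsilon>)))"
      using p(3) \<epsilon>(3) by linarith
    then have "?K * (ln (real (card \<Omega>)) / real (?n choose r) - \<delta>)
       \<le> ?K * (h - \<kappa> * ?b / real p - real q * (\<epsilon> * (1 + ln (1 / \<epsilon>))))"
      by (intro mult_left_mono) auto
    with big have large: "?K * (ln (real (card \<Omega>)) / real (?n choose r) - \<delta>) \<le> (\<Sum>A\<in>nsets U r. ln (real (card (Ch A))))"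
      by linarith
    show "\<exists>Ch. (\<forall>A\<in>nsets U r. Ch A \<noteq> {} \<and> Ch A \<subseteq> (\<lambda>w. X w A) ` \<Omega>)
       \<and> (\<forall>\<chi>. (\<forall>A\<in>nsets U r. \<chi> A \<in> Ch A) \<longrightarrow> (\<exists>w\<in>\<Omega>. \<forall>A\<in>nsets U r. X w A = \<chi> A))
       \<and> ?K * (ln (real (card \<Omega>)) / real (?n choose r) - \<delta>)
           \<le> (\<Sum>A\<in>nsets U r. ln (real (card (Ch A))))"
      by (rule exI [of _ Ch], intro conjI Ch large)
  qed
qed

section \<open>Diagrams, renamings and induced structures\<close>

lemma finite_tuples: "finite V \<Longrightarrow> finite (tuples V k)"
  using finite_lists_length_eq [of V k] by (simp add: tuples_def conj_commute)

lemma card_tuples: "finite V \<Longrightarrow> card (tuples V k) = card V ^ k"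
  using card_lists_length_eq [of V k] by (simp add: tuples_def conj_commute)

lemma tuples_mono: "A \<subseteq> B \<Longrightarrow> tuples A k \<subseteq> tuples B k"
  by (auto simp: tuples_def)

lemma map_mem_tuples_iff: "inj f \<Longrightarrow> map f a \<in> tuples (f ` A) k \<longleftrightarrow> a \<in> tuples A k"
  by (auto simp: tuples_def inj_image_subset_iff)

lemma distinct_tuples_enumerate:
  assumes "A \<in> nsets V r"
  obtains a where "a \<in> distinct_tuples V r" "set a = A"
proof -
  have A: "A \<subseteq> V" "finite A" "card A = r" using assms by (auto simp: nsets_def)
  obtain a where "set a = A" "distinct a" using finite_distinct_list [OF A(2)] by blast
  then show ?thesis
    using A that distinct_card [of a] by (auto simp: distinct_tuples_def tuples_def)
qed

lemma set_distinct_tuple: "a \<in> distinct_tuples V r \<Longrightarrow> set a \<in> nsets V r"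
  using distinct_card [of a] by (auto simp: distinct_tuples_def tuples_def nsets_def)

lemma Rel_in_Diag:
  assumes "R \<in> symbols L" "a \<in> tuples A (sym_arity L R)"
  shows "Rel R (map Cst a) \<in> Diag L N A \<longleftrightarrow> a \<in> interp N R"
proof -
  have "map (term_value e) (map Cst a) = a" for e
    by (simp add: o_def)
  then show ?thesis using assms by (auto simp: Diag_def tuples_def simp del: map_map)
qed

lemma sat_cong_interp:
  assumes "\<And>R. R \<in> symbols L \<Longrightarrow> interp N R \<inter> tuples A (sym_arity L R) = interp N' R \<inter> tuples A (sym_arity L R)"
  shows "qf_formula L (Cst ` A) \<phi> \<Longrightarrow> sat N e \<phi> \<longleftrightarrow> sat N' e \<phi>"
proof (induction \<phi>)
  case (Rel R ts)
  have "map (term_value e) ts \<in> tuples A (sym_arity L R)"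
    using Rel by (fastforce simp: tuples_def)
  then show ?case using assms [of R] Rel by auto
qed auto

text \<open>A diagram is determined by its atomic sentences, so it carries the same information as the
  relations restricted to tuples from \<open>A\<close>.\<close>

lemma Diag_eq_iff:
  "Diag L N A = Diag L N' A \<longleftrightarrow>
    (\<forall>R\<in>symbols L. interp N R \<inter> tuples A (sym_arity L R) = interp N' R \<inter> tuples A (sym_arity L R))"
proof
  assume eq: "Diag L N A = Diag L N' A"
  have "a \<in> interp N R \<longleftrightarrow> a \<in> interp N' R" if "R \<in> symbols L" "a \<in> tuples A (sym_arity L R)" for R a
    using Rel_in_Diag [OF that, of N] Rel_in_Diag [OF that, of N'] eq by simp
  then show "\<forall>R\<in>symbols L. interp N R \<inter> tuples A (sym_arity L R) = interp N' R \<inter> tuples A (sym_arity L R)"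
    by blast
next
  assume "\<forall>R\<in>symbols L. interp N R \<inter> tuples A (sym_arity L R) = interp N' R \<inter> tuples A (sym_arity L R)"
  then show "Diag L N A = Diag L N' A"
    using sat_cong_interp [of L N A N'] by (auto simp: Diag_def)
qed

lemma term_value_subst_term: "term_value e (subst_term (\<lambda>i. Cst (a ! i)) t) = term_value ((!) a) t"
  by (cases t) auto

lemma sat_inst: "sat N e (map_qff id (subst_term (\<lambda>i. Cst (a ! i))) \<phi>) \<longleftrightarrow> sat N ((!) a) \<phi>"
  by (induction \<phi>) (auto simp: term_value_subst_term o_def)

lemma qf_formula_inst:
  "qf_formula L (Var ` {..<length a}) \<phi> \<Longrightarrow> qf_formula L (Cst ` set a) (map_qff id (subst_term (\<lambda>i. Cst (a ! i))) \<phi>)"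
proof (induction \<phi>)
  case (Rel R ts)
  have "subst_term (\<lambda>i. Cst (a ! i)) t \<in> Cst ` set a" if "t \<in> set ts" for t
    using Rel that by (auto dest!: subsetD)
  then show ?case using Rel by auto
qed auto

text \<open>Every constant of a sentence over \<open>set a\<close> can be read as a variable standing for a position of \<open>a\<close>.\<close>

lemma qf_formula_inst_surj:
  "qf_formula L (Cst ` set a) \<phi> \<Longrightarrow>
     \<exists>\<psi>. qf_formula L (Var ` {..<length a}) \<psi> \<and> \<phi> = map_qff id (subst_term (\<lambda>i. Cst (a ! i))) \<psi>"
proof (induction \<phi>)
  let ?s = "subst_term (\<lambda>i. Cst (a ! i))"
  have ex: "\<exists>t'. t' \<in> Var ` {..<length a} \<and> ?s t' = t" if t_in: "t \<in> Cst ` set a" for t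
  proof -
    obtain x where "x \<in> set a" and t: "t = Cst x" using t_in by auto
    then obtain i where "i < length a" "a ! i = x" by (auto simp: in_set_conv_nth)
    then show ?thesis using t by (intro exI [of _ "Var i"]) simp
  qed
  define g where "g = (\<lambda>t. SOME t'. t' \<in> Var ` {..<length a} \<and> ?s t' = t)"
  have g: "g t \<in> Var ` {..<length a} \<and> ?s (g t) = t" if "t \<in> Cst ` set a" for t
    unfolding g_def by (rule someI_ex) (rule ex [OF that])
  {
    case (Eq s t)
    then show ?case using g [of s] g [of t] by (intro exI [of _ "Eq (g s) (g t)"]) auto
  next
    case (Rel R ts)
    then have "set ts \<subseteq> Cst ` set a" by simp
    then have "map ?s (map g ts) = ts" "set (map g ts) \<subseteq> Var ` {..<length a}"
      using g by (auto intro!: map_idI)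
    then show ?case using Rel by (intro exI [of _ "Rel R (map g ts)"]) auto
  next
    case (Neg \<phi>)
    then have "qf_formula L (Cst ` set a) \<phi>" by simp
    from Neg.IH [OF this] obtain \<psi> where "qf_formula L (Var ` {..<length a}) \<psi>" "\<phi> = map_qff id ?s \<psi>"
      by blast
    then show ?case by (intro exI [of _ "Neg \<psi>"]) (simp add: id_def)
  next
    case (Conj \<phi>1 \<phi>2)
    then have "qf_formula L (Cst ` set a) \<phi>1" "qf_formula L (Cst ` set a) \<phi>2" by simp_all
    from Conj.IH(1) [OF this(1)] Conj.IH(2) [OF this(2)] obtain \<psi>1 \<psi>2
      where "qf_formula L (Var ` {..<length a}) \<psi>1" "\<phi>1 = map_qff id ?s \<psi>1"
      and "qf_formula L (Var ` {..<length a}) \<psi>2" "\<phi>2 = map_qff id ?s \<psi>2"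
      by blast
    then show ?case by (intro exI [of _ "Conj \<psi>1 \<psi>2"]) (simp add: id_def)
  next
    case (Disj \<phi>1 \<phi>2)
    then have "qf_formula L (Cst ` set a) \<phi>1" "qf_formula L (Cst ` set a) \<phi>2" by simp_all
    from Disj.IH(1) [OF this(1)] Disj.IH(2) [OF this(2)] obtain \<psi>1 \<psi>2
      where "qf_formula L (Var ` {..<length a}) \<psi>1" "\<phi>1 = map_qff id ?s \<psi>1"
      and "qf_formula L (Var ` {..<length a}) \<psi>2" "\<phi>2 = map_qff id ?s \<psi>2"
      by blast
    then show ?case by (intro exI [of _ "Disj \<psi>1 \<psi>2"]) (simp add: id_def)
  }
qed

text \<open>This links the two descriptions of a colour: as a type instantiated at an enumeration of the set,
  and as a diagram, which does not refer to an enumeration.\<close>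

lemma inst_type_qftp: "inst_type (qftp L N a) a = Diag L N (set a)"
proof (intro equalityI subsetI)
  fix \<phi> assume "\<phi> \<in> inst_type (qftp L N a) a"
  then show "\<phi> \<in> Diag L N (set a)"
    by (auto simp: inst_type_def subst_type_def qftp_def Diag_def sat_inst intro: qf_formula_inst)
next
  fix \<phi> assume \<phi>: "\<phi> \<in> Diag L N (set a)"
  then obtain \<psi> where "qf_formula L (Var ` {..<length a}) \<psi>" "\<phi> = map_qff id (subst_term (\<lambda>i. Cst (a ! i))) \<psi>"
    using qf_formula_inst_surj unfolding Diag_def by blast
  then show "\<phi> \<in> inst_type (qftp L N a) a"
    using \<phi> by (auto simp: inst_type_def subst_type_def qftp_def Diag_def sat_inst)
qed

lemma map_qff_cong_formula:
  "qf_formula L T \<phi> \<Longrightarrow> (\<And>t. t \<in> T \<Longrightarrow> f t = g t) \<Longrightarrow> map_qff id f \<phi> = map_qff id g \<phi>"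
  by (induction \<phi>) auto

lemma inst_permute_type:
  assumes "complete_type L r p" "\<mu> permutes {..<r}" "length a = r"
  shows "inst_type (permute_type \<mu> p) a = inst_type p (permute_list \<mu> a)"
proof -
  have "map_qff id (subst_term (\<lambda>i. Cst (a ! i))) (map_qff id (subst_term (\<lambda>i. Var (\<mu> i))) \<phi>)
      = map_qff id (subst_term (\<lambda>i. Cst (permute_list \<mu> a ! i))) \<phi>" if "\<phi> \<in> p" for \<phi>
  proof -
    have qf: "qf_formula L (Var ` {..<r}) \<phi>" using assms(1) that by (auto simp: complete_type_def)
    show ?thesis
      unfolding qff.map_comp id_comp
      by (rule map_qff_cong_formula [OF qf]) (use assms(2,3) in \<open>auto simp: permute_list_nth\<close>)
  qed
  then show ?thesis
    unfolding inst_type_def permute_type_def subst_type_def image_image by (rule image_cong [OF refl])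
qed

lemma qftp_in_proper_types:
  assumes "N \<in> H" "a \<in> distinct_tuples (universe N) r"
  shows "qftp L N a \<in> proper_types L r H"
  using assms
  by (auto simp: proper_types_def complete_type_def proper_type_def realized_in_def qftp_def
      distinct_tuples_def tuples_def nth_eq_iff_index_eq)

definition rename :: "('a \<Rightarrow> 'b) \<Rightarrow> ('s, 'a) rel_struct \<Rightarrow> ('s, 'b) rel_struct" where
  "rename f N = \<lparr>universe = f ` universe N, interp = (\<lambda>R. map f ` interp N R)\<rparr>"

definition induced :: "'s rel_lang \<Rightarrow> ('s, 'a) rel_struct \<Rightarrow> 'a set \<Rightarrow> ('s, 'a) rel_struct" where
  "induced L N U = \<lparr>universe = U,
     interp = (\<lambda>R. if R \<in> symbols L then interp N R \<inter> tuples U (sym_arity L R) else {})\<rparr>"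

lemma universe_rename [simp]: "universe (rename f N) = f ` universe N"
  by (simp add: rename_def)

lemma universe_induced [simp]: "universe (induced L N U) = U"
  by (simp add: induced_def)

lemma rename_rename: "rename f (rename g N) = rename (f \<circ> g) N"
  by (simp add: rename_def image_image o_def)

lemma rename_id [simp]: "rename id N = N"
  by (simp add: rename_def)

lemma Diag_induced: "A \<subseteq> U \<Longrightarrow> Diag L (induced L N U) A = Diag L N A"
  unfolding Diag_eq_iff using tuples_mono [of A U] by (auto simp: induced_def)

lemma Diag_rename_eq_iff:
  fixes N N' :: "('s, 'a) rel_struct"
  assumes "inj f"
  shows "Diag L (rename f N) (f ` A) = Diag L (rename f N') (f ` A) \<longleftrightarrow> Diag L N A = Diag L N' A"
proof -
  have "map f ` interp N R \<inter> tuples (f ` A) k = map f ` (interp N R \<inter> tuples A k)" for N :: "('s, 'a) rel_struct" and R k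
    using map_mem_tuples_iff [OF assms] by blast
  moreover have "inj (map f)" using assms by (simp add: inj_mapI)
  ultimately show ?thesis
    unfolding Diag_eq_iff by (simp add: rename_def inj_image_eq_iff)
qed

lemma is_structure_rename:
  assumes "is_structure L N" "inj f"
  shows "is_structure L (rename f N)"
  using assms(1) map_mem_tuples_iff [OF assms(2), of _ "universe N"]
  unfolding is_structure_def by (force simp: rename_def)

lemma isomorphic_rename:
  assumes "inj f"
  shows "isomorphic L N (rename f N)"
  unfolding isomorphic_def
proof (intro exI [of _ f] conjI ballI)
  show "bij_betw f (universe N) (universe (rename f N))"
    using inj_on_subset [OF assms] by (simp add: bij_betw_def)
  show "a \<in> interp N R \<longleftrightarrow> map f a \<in> interp (rename f N) R" for a R
    using assms by (simp add: rename_def inj_image_mem_iff inj_mapI)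
qed

text \<open>The entries of a tuple in a relation number at most \<open>r\<close>, so they lie in a common \<open>r\<close>-set, whose
  diagram records whether the relation holds.\<close>

lemma structure_eqI:
  fixes N N' :: "('s, 'a) rel_struct"
  assumes "is_structure L N" "is_structure L N'" "universe N = V" "universe N' = V"
    and "finite V" "r \<le> card V" "\<And>R. R \<in> symbols L \<Longrightarrow> sym_arity L R \<le> r"
    and diag: "\<And>A. A \<in> nsets V r \<Longrightarrow> Diag L N A = Diag L N' A"
  shows "N = N'"
proof -
  have sub: "interp N1 R \<subseteq> interp N2 R"
    if N1: "is_structure L N1" "universe N1 = V" and eq: "\<And>A. A \<in> nsets V r \<Longrightarrow> Diag L N1 A = Diag L N2 A"
    for N1 N2 :: "('s, 'a) rel_struct" and R
  proof
    fix a assume a: "a \<in> interp N1 R"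
    then have R: "R \<in> symbols L" using N1(1) by (auto simp: is_structure_def)
    then have a': "a \<in> tuples V (sym_arity L R)" using N1 a by (auto simp: is_structure_def)
    have "card (set a) \<le> r"
      using a' assms(7) [OF R] card_length [of a] by (simp add: tuples_def)
    moreover have "set a \<subseteq> V" using a' by (simp add: tuples_def)
    ultimately obtain A where A: "set a \<subseteq> A" "A \<subseteq> V" "card A = r"
      using exists_subset_between [of "set a" r V] assms(5,6) by blast
    then have "A \<in> nsets V r" using assms(5) finite_subset by (auto simp: nsets_def)
    moreover have "a \<in> tuples A (sym_arity L R)" using a' A by (simp add: tuples_def)
    ultimately show "a \<in> interp N2 R"
      using eq a R unfolding Diag_eq_iff by blast
  qed
  have "interp N = interp N'"
    using sub [OF assms(1,3) diag] sub [OF assms(2,4) diag [symmetric]] by blast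
  then show ?thesis using assms(3,4) by simp
qed

lemma finite_structures:
  fixes L :: "'s rel_lang" and V :: "'a set"
  assumes "finite (symbols L)" "finite V"
  shows "finite {N :: ('s, 'a) rel_struct. is_structure L N \<and> universe N = V}"
proof (rule finite_subset)
  let ?P = "\<Pi>\<^sub>E R\<in>symbols L. Pow (tuples V (sym_arity L R))"
  let ?mk = "\<lambda>g. \<lparr>universe = V, interp = (\<lambda>R. if R \<in> symbols L then g R else {})\<rparr>"
  show "finite (?mk ` ?P)"
    using assms finite_tuples by (intro finite_imageI finite_PiE) auto
  show "{N. is_structure L N \<and> universe N = V} \<subseteq> ?mk ` ?P"
  proof
    fix N :: "('s, 'a) rel_struct" assume "N \<in> {N. is_structure L N \<and> universe N = V}"
    then have N: "is_structure L N" "universe N = V" by auto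
    have "restrict (interp N) (symbols L) \<in> ?P"
      using N by (auto simp: is_structure_def)
    moreover have "interp N = (\<lambda>R. if R \<in> symbols L then restrict (interp N) (symbols L) R else {})"
      using N by (auto simp: is_structure_def fun_eq_iff)
    then have "N = ?mk (restrict (interp N) (symbols L))" using N(2) by (simp del: restrict_apply)
    ultimately show "N \<in> ?mk ` ?P" by blast
  qed
qed

text \<open>The bound depends only on the size of \<open>A\<close>; this keeps the number of colours independent of the number of
  vertices.\<close>

lemma card_Diags_le:
  assumes "finite (symbols L)" "finite A"
  shows "card ((\<lambda>N. Diag L N A) ` \<Omega>) \<le> (\<Prod>R\<in>symbols L. 2 ^ (card A ^ sym_arity L R))"
proof -
  let ?P = "\<Pi>\<^sub>E R\<in>symbols L. Pow (tuples A (sym_arity L R))"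
  let ?D = "\<lambda>g. Diag L \<lparr>universe = A, interp = g\<rparr> A"
  have "Diag L N A = ?D (\<lambda>R\<in>symbols L. interp N R \<inter> tuples A (sym_arity L R))" for N
    unfolding Diag_eq_iff by auto
  then have "(\<lambda>N. Diag L N A) ` \<Omega> \<subseteq> ?D ` ?P" by (fastforce intro!: image_eqI)
  moreover have fin: "finite ?P" using assms finite_tuples by (intro finite_PiE) auto
  ultimately have "card ((\<lambda>N. Diag L N A) ` \<Omega>) \<le> card ?P"
    by (meson card_mono card_image_le finite_imageI le_trans)
  also have "\<dots> = (\<Prod>R\<in>symbols L. 2 ^ (card A ^ sym_arity L R))"
    using assms by (simp add: card_PiE card_Pow finite_tuples card_tuples)
  finally show ?thesis .
qed

section \<open>Random templates from boxes\<close>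

locale relational_property =
  fixes L :: "'s rel_lang" and H :: "('s, 'a) rel_struct set" and r :: nat
  assumes finite_symbols: "finite (symbols L)"
    and arity_le: "R \<in> symbols L \<Longrightarrow> sym_arity L R \<le> r"
    and r_pos: "1 \<le> r"
    and hereditary: "hereditary_property L H"
begin

definition members :: "'a set \<Rightarrow> ('s, 'a) rel_struct set" where
  "members V = {N \<in> H. universe N = V}"

lemmas hereditaryD = hereditary [unfolded hereditary_property_def, THEN conjunct2]

lemma member_structure: "N \<in> H \<Longrightarrow> is_structure L N" "N \<in> H \<Longrightarrow> finite (universe N)"
  using hereditaryD [THEN conjunct1] by blast+

lemma finite_members: "finite V \<Longrightarrow> finite (members V)"
  by (rule finite_subset [OF _ finite_structures [OF finite_symbols, of V]])
     (auto simp: members_def member_structure)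

lemma rename_member:
  assumes "N \<in> H" "bij \<pi>"
  shows "rename \<pi> N \<in> H"
proof -
  have "inj \<pi>" using assms(2) by (rule bij_is_inj)
  then have "is_structure L (rename \<pi> N)" "isomorphic L N (rename \<pi> N)"
    using assms(1) by (simp_all add: is_structure_rename isomorphic_rename member_structure)
  then show ?thesis
    using hereditaryD [THEN conjunct2, THEN conjunct1] assms(1) by blast
qed

lemma bij_betw_rename:
  assumes "bij \<pi>"
  shows "bij_betw (rename \<pi>) (members V) (members (\<pi> ` V))"
proof (rule bij_betw_byWitness [where f' = "rename (inv \<pi>)"])
  have inv: "inv \<pi> \<circ> \<pi> = id" "\<pi> \<circ> inv \<pi> = id" "bij (inv \<pi>)"
    using assms bij_is_inj [OF assms] bij_is_surj [OF assms] by (simp_all add: bij_imp_bij_inv surj_iff inj_iff)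
  have im: "inv \<pi> ` \<pi> ` V = V" by (simp only: image_comp inv) simp
  show "\<forall>N\<in>members V. rename (inv \<pi>) (rename \<pi> N) = N" by (simp add: rename_rename inv)
  show "\<forall>N\<in>members (\<pi> ` V). rename \<pi> (rename (inv \<pi>) N) = N" by (simp add: rename_rename inv)
  show "rename \<pi> ` members V \<subseteq> members (\<pi> ` V)"
    using assms by (auto simp: members_def rename_member)
  show "rename (inv \<pi>) ` members (\<pi> ` V) \<subseteq> members V"
    using inv(3) im by (auto simp: members_def rename_member)
qed

lemma card_members_eq:
  assumes "finite V" "finite V'" "card V = card V'"
  shows "card (members V) = card (members V')"
proof -
  obtain \<pi> where "\<pi> permutes (V \<union> V')" "\<pi> ` V = V'"
    using ex_permutation_between_pairs [of "V \<union> V'" "{}" V "{}" V'] assms by auto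
  then show ?thesis
    using bij_betw_same_card [OF bij_betw_rename [of \<pi> V]] permutes_bij by blast
qed

lemma induced_member:
  assumes "N \<in> H" "U \<subseteq> universe N" "U \<noteq> {}"
  shows "induced L N U \<in> H"
proof -
  have "is_structure L (induced L N U)"
    using assms(3) by (simp add: is_structure_def induced_def)
  moreover have "substructure L (induced L N U) N"
    using assms(2) by (auto simp: substructure_def induced_def)
  ultimately show ?thesis
    using hereditaryD [THEN conjunct2, THEN conjunct2] assms(1) by blast
qed

lemma finite_full_subpatterns:
  assumes "finite (universe M)"
  shows "finite {N. full_subpattern L r H N M}"
  by (rule finite_subset [OF _ finite_structures [OF finite_symbols assms]])
     (auto simp: full_subpattern_def full_subpattern_by_def)

text \<open>A full subpattern is determined by its choice function, and randomness provides one that lies in \<open>H\<close>.\<close>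

lemma sub_num_le_members:
  assumes "M \<in> random_templates L r n H" "r \<le> n"
  shows "sub_num L r H M \<le> card (members (universe M))"
proof -
  have M: "H_random L r H M" "finite (universe M)" "card (universe M) = n"
    using assms(1) by (auto simp: random_templates_def)
  have "{N. full_subpattern L r H N M} \<subseteq> members (universe M)"
  proof
    fix N assume "N \<in> {N. full_subpattern L r H N M}"
    then obtain \<chi> where \<chi>: "choice_function L r H M \<chi>" and N: "full_subpattern_by L r N \<chi> M"
      by (auto simp: full_subpattern_def)
    obtain N' where N': "N' \<in> H" "full_subpattern_by L r N' \<chi> M"
      using M(1) \<chi> by (auto simp: H_random_def)
    have "N = N'"
      using N N' M assms(2) arity_le
      by (intro structure_eqI [of L N N' "universe M" r]) (auto simp: full_subpattern_by_def)
    then show "N \<in> members (universe M)"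
      using N' by (auto simp: members_def full_subpattern_by_def)
  qed
  then show ?thesis
    unfolding sub_num_def by (rule card_mono [OF finite_members [OF M(2)]])
qed

text \<open>The template that permits exactly the diagrams in \<open>C A\<close> on each \<open>r\<close>-set \<open>A\<close>.  Requiring
  \<open>inst_type p a \<in> C (set a)\<close> makes it invariant under permuting \<open>a\<close> and \<open>p\<close> together.\<close>

definition box_template :: "'a set \<Rightarrow> ('a set \<Rightarrow> ('s, 'a) form set set) \<Rightarrow> ('s, 'a) tstruct" where
  "box_template U C = \<lparr>universe = U,
     interp = (\<lambda>p. if p \<in> proper_types L r H then {a \<in> distinct_tuples U r. inst_type p a \<in> C (set a)} else {})\<rparr>"

text \<open>Since the diagrams in \<open>C A\<close> are realised in members of \<open>H\<close>, each is an instance of a type of \<open>H\<close> at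
  every enumeration of \<open>A\<close>; so the choices that the template offers at \<open>A\<close> are exactly those in \<open>C A\<close>.
  Different choice functions yield different subpatterns, whence the product.\<close>

lemma box_template_random:
  assumes U: "finite U" "card U = n" "r \<le> n"
    and C: "\<And>A. A \<in> nsets U r \<Longrightarrow> C A \<noteq> {}"
      "\<And>A c. A \<in> nsets U r \<Longrightarrow> c \<in> C A \<Longrightarrow> \<exists>N\<in>members U. Diag L N A = c"
    and choices: "\<And>\<chi>. (\<And>A. A \<in> nsets U r \<Longrightarrow> \<chi> A \<in> C A) \<Longrightarrow> \<exists>N\<in>members U. \<forall>A\<in>nsets U r. Diag L N A = \<chi> A"
  shows "box_template U C \<in> random_templates L r n H"
    and "(\<Prod>A\<in>nsets U r. card (C A)) \<le> sub_num L r H (box_template U C)"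
proof -
  let ?M = "box_template U C"
  have uni [simp]: "universe ?M = U" by (simp add: box_template_def)
  have mem: "a \<in> interp ?M p \<longleftrightarrow> p \<in> proper_types L r H \<and> a \<in> distinct_tuples U r \<and> inst_type p a \<in> C (set a)" for a p
    by (simp add: box_template_def)
  have type_exists: "\<exists>p\<in>proper_types L r H. inst_type p a = c"
    if ac: "a \<in> distinct_tuples U r" "c \<in> C (set a)" for a c
  proof -
    obtain N where N: "N \<in> members U" "Diag L N (set a) = c"
      using C(2) [OF set_distinct_tuple [OF ac(1)] ac(2)] by blast
    then have "qftp L N a \<in> proper_types L r H"
      using ac(1) by (intro qftp_in_proper_types) (auto simp: members_def)
    then show ?thesis using N(2) inst_type_qftp by metis
  qed
  have struct: "is_structure (type_lang L r H) ?M"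
    using U r_pos by (auto simp: is_structure_def mem type_lang_def distinct_tuples_def box_template_def)
  have "\<exists>a\<in>distinct_tuples U r. set a = A \<and> (\<exists>p\<in>proper_types L r H. a \<in> interp ?M p)"
    if A: "A \<in> nsets U r" for A
  proof -
    obtain a where a: "a \<in> distinct_tuples U r" "set a = A" using distinct_tuples_enumerate [OF A] .
    obtain c where "c \<in> C A" using C(1) [OF A] by blast
    then show ?thesis using type_exists [OF a(1), of c] a by (auto simp: mem)
  qed
  then have complete: "complete_tstruct L r H ?M"
    using struct by (simp add: complete_tstruct_def)
  have template: "template L r H ?M"
    unfolding template_def
  proof (intro conjI ballI allI impI complete)
    show "a \<notin> interp ?M p" if "a \<in> tuples (universe ?M) r - distinct_tuples (universe ?M) r" for p a
      using that by (simp add: mem)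
  next
    fix p p' \<mu> a
    assume p: "p \<in> proper_types L r H" "p' \<in> proper_types L r H"
      and \<mu>: "\<mu> permutes {..<r} \<and> p = permute_type \<mu> p'" and a: "a \<in> distinct_tuples (universe ?M) r"
    have len: "length a = r" using a by (simp add: distinct_tuples_def tuples_def)
    have "inst_type p a = inst_type p' (permute_list \<mu> a)"
      using \<mu> p len inst_permute_type [of L r p' \<mu> a] by (auto simp: proper_types_def)
    moreover have "set (permute_list \<mu> a) = set a" using \<mu> len by simp
    moreover have "permute_list \<mu> a \<in> distinct_tuples U r"
      using a \<mu> len by (simp add: distinct_tuples_def tuples_def)
    ultimately show "a \<in> interp ?M p \<longleftrightarrow> permute_list \<mu> a \<in> interp ?M p'"
      using p a by (simp add: mem)
  qed
  have Ch: "Ch L r H ?M A = C A" if A: "A \<in> nsets U r" for A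
  proof (intro equalityI subsetI)
    show "c \<in> C A" if "c \<in> Ch L r H ?M A" for c
      using that by (auto simp: Ch_def mem)
    show "c \<in> Ch L r H ?M A" if c: "c \<in> C A" for c
    proof -
      obtain a where a: "a \<in> distinct_tuples U r" "set a = A" using distinct_tuples_enumerate [OF A] .
      then obtain p where "p \<in> proper_types L r H" "inst_type p a = c" using type_exists [OF a(1), of c] c by blast
      then show ?thesis using a c by (auto simp: Ch_def mem)
    qed
  qed
  have over: "Ch L r H ?M A \<subseteq> proper_types_over L r U H" for A
    by (auto simp: Ch_def proper_types_over_def)
  have choice_iff: "choice_function L r H ?M \<chi> \<longleftrightarrow> (\<forall>A\<in>nsets U r. \<chi> A \<in> C A)" for \<chi>
    using Ch over by (fastforce simp: choice_function_def)
  have by_iff: "full_subpattern_by L r N \<chi> ?M \<longleftrightarrow> is_structure L N \<and> universe N = U \<and> (\<forall>A\<in>nsets U r. Diag L N A = \<chi> A)" for N \<chi>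
    by (simp add: full_subpattern_by_def)
  have realize: "\<exists>N\<in>H. full_subpattern_by L r N \<chi> ?M" if ch: "choice_function L r H ?M \<chi>" for \<chi>
  proof -
    obtain N where "N \<in> members U" "\<forall>A\<in>nsets U r. Diag L N A = \<chi> A"
      using choices [of \<chi>] ch by (auto simp: choice_iff)
    then show ?thesis by (auto simp: members_def by_iff member_structure)
  qed
  then have "H_random L r H ?M" by (simp add: H_random_def complete)
  then show "?M \<in> random_templates L r n H"
    using template U by (simp add: random_templates_def)
  have "(\<Pi>\<^sub>E A\<in>nsets U r. C A) \<subseteq> (\<lambda>N. restrict (Diag L N) (nsets U r)) ` {N. full_subpattern L r H N ?M}"
  proof
    fix \<chi> assume \<chi>: "\<chi> \<in> (\<Pi>\<^sub>E A\<in>nsets U r. C A)"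
    then have ch: "choice_function L r H ?M \<chi>" by (auto simp: choice_iff)
    then obtain N where N: "full_subpattern_by L r N \<chi> ?M" using realize by blast
    then have "restrict (Diag L N) (nsets U r) = \<chi>"
      using \<chi> by (auto simp: by_iff fun_eq_iff PiE_def extensional_def)
    then show "\<chi> \<in> (\<lambda>N. restrict (Diag L N) (nsets U r)) ` {N. full_subpattern L r H N ?M}"
      using N ch by (auto simp: full_subpattern_def)
  qed
  moreover have fin: "finite {N. full_subpattern L r H N ?M}"
    using U by (intro finite_full_subpatterns) simp
  ultimately have "card (\<Pi>\<^sub>E A\<in>nsets U r. C A) \<le> sub_num L r H ?M"
    unfolding sub_num_def by (rule surj_card_le [rotated])
  then show "(\<Prod>A\<in>nsets U r. card (C A)) \<le> sub_num L r H ?M"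
    by (simp add: card_PiE finite_imp_finite_nsets [OF U(1)])
qed

end

section \<open>The enumeration rate\<close>

context relational_property
begin

lemma finite_sub_nums:
  assumes "r \<le> n"
  shows "finite (sub_num L r H ` random_templates L r n H)"
proof (cases "random_templates L r n H = {}")
  case False
  then obtain M0 where M0: "M0 \<in> random_templates L r n H" by blast
  have "sub_num L r H M \<le> card (members (universe M0))" if "M \<in> random_templates L r n H" for M
    using sub_num_le_members [OF that assms] card_members_eq [of "universe M" "universe M0"] that M0
    by (simp add: random_templates_def)
  then show ?thesis by (intro finite_subset [OF _ finite_atMost]) auto
qed simp

lemma sub_num_le_ex_num:
  assumes "M \<in> random_templates L r n H" "r \<le> n"
  shows "sub_num L r H M \<le> ex_num L r n H"
  using assms finite_sub_nums [OF assms(2)] by (auto simp: ex_num_def intro: Max_ge)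

lemma ex_num_le_members:
  assumes "finite V" "card V = n" "r \<le> n"
  shows "ex_num L r n H \<le> card (members V)"
proof (cases "random_templates L r n H = {}")
  case False
  have "sub_num L r H M \<le> card (members V)" if "M \<in> random_templates L r n H" for M
    using sub_num_le_members [OF that assms(3)] card_members_eq [of "universe M" V] that assms
    by (simp add: random_templates_def)
  then show ?thesis
    using False finite_sub_nums [OF assms(3)] by (simp add: ex_num_def)
qed (simp add: ex_num_def)

text \<open>On an \<open>r\<close>-set, a symbol of arity \<open>l\<close> has \<open>r ^ l\<close> tuples, each of which is in the relation or not.\<close>

definition num_colours :: nat where
  "num_colours = (\<Prod>R\<in>symbols L. 2 ^ (r ^ sym_arity L R))"

lemma num_colours_pos: "1 \<le> num_colours"
  unfolding num_colours_def by (intro prod_ge_1) auto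

lemma card_Diags_le_num_colours:
  assumes "A \<in> nsets V r"
  shows "card ((\<lambda>N. Diag L N A) ` \<Omega>) \<le> num_colours"
  using assms card_Diags_le [OF finite_symbols, of A \<Omega>] by (auto simp: num_colours_def nsets_def)

lemma symmetric_submodular_entropy:
  assumes "finite V" "members V \<noteq> {}"
  shows "symmetric_submodular (entropy (Diag L) (members V)) V r (ln (real num_colours))"
proof
  let ?E = "entropy (Diag L) (members V)"
  note fin = finite_members [OF assms(1)]
  show "finite V" by fact
  show "?E (G \<union> J \<union> K) + ?E G \<le> ?E (G \<union> J) + ?E (G \<union> K)" for G J K
    by (rule entropy_submodular [OF fin])
  show "?E J \<le> ?E K" if "J \<subseteq> K" for J K
    by (rule entropy_mono [OF fin that])
  show "?E {} = 0" by (rule entropy_empty)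
  show "?E {A} \<le> ln (real num_colours)" if "A \<in> nsets V r" for A
    by (rule entropy_single_le_ln [where X = "Diag L", OF fin assms(2) card_Diags_le_num_colours [OF that]])
  show "?E ((`) \<pi> ` J) = ?E J" if \<pi>: "\<pi> permutes V" for \<pi> J
  proof (rule entropy_invariant)
    show "bij_betw (rename \<pi>) (members V) (members V)"
      using bij_betw_rename [OF permutes_bij [OF \<pi>], of V] permutes_image [OF \<pi>] by simp
    show "(\<forall>A\<in>(`) \<pi> ` J. Diag L (rename \<pi> N) A = Diag L (rename \<pi> N') A) \<longleftrightarrow> (\<forall>A\<in>J. Diag L N A = Diag L N' A)"
      for N N'
      by (simp add: Diag_rename_eq_iff [OF permutes_inj [OF \<pi>]])
  qed
qed

lemma entropy_members:
  assumes "finite V" "members V \<noteq> {}" "r \<le> card V"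
  shows "entropy (Diag L) (members V) (nsets V r) = ln (real (card (members V)))"
proof (rule entropy_determined [OF finite_members [OF assms(1)] assms(2)])
  fix N N' assume "N \<in> members V" "N' \<in> members V" "\<forall>A\<in>nsets V r. Diag L N A = Diag L N' A"
  then show "N = N'"
    using assms arity_le
    by (intro structure_eqI [of L N N' V r]) (auto simp: members_def member_structure)
qed

text \<open>A rich box of diagrams on a \<open>k\<close>-subset \<open>U\<close> of a large \<open>V\<close> is realised by members on \<open>V\<close>, whose
  restrictions to \<open>U\<close> lie in \<open>H\<close> by heredity.  Hence the box is an \<open>H\<close>-random template of size \<open>k\<close>.\<close>

lemma members_rate_le_ex_rate:
  assumes "\<delta> > 0" "r \<le> k"
  shows "\<exists>n0. \<forall>V. finite V \<longrightarrow> n0 \<le> card V \<longrightarrow> members V \<noteq> {} \<longrightarrow>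
    1 \<le> ex_num L r k H \<and>
    real (k choose r) * (ln (real (card (members V))) / real (card V choose r) - \<delta>) \<le> ln (real (ex_num L r k H))"
proof -
  obtain n0 where n0: "\<And>(X :: ('s, 'a) rel_struct \<Rightarrow> 'a set \<Rightarrow> ('s, 'a) form set) \<Omega> V U.
     symmetric_submodular (entropy X \<Omega>) V r (ln (real num_colours)) \<Longrightarrow> finite \<Omega> \<Longrightarrow> \<Omega> \<noteq> {}
     \<Longrightarrow> entropy X \<Omega> (nsets V r) = ln (real (card \<Omega>))
     \<Longrightarrow> (\<forall>A\<in>nsets V r. card ((\<lambda>w. X w A) ` \<Omega>) \<le> num_colours)
     \<Longrightarrow> U \<subseteq> V \<Longrightarrow> card U = k \<Longrightarrow> n0 \<le> card V \<Longrightarrow>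
     (\<exists>Ch. (\<forall>A\<in>nsets U r. Ch A \<noteq> {} \<and> Ch A \<subseteq> (\<lambda>w. X w A) ` \<Omega>)
       \<and> (\<forall>\<chi>. (\<forall>A\<in>nsets U r. \<chi> A \<in> Ch A) \<longrightarrow> (\<exists>w\<in>\<Omega>. \<forall>A\<in>nsets U r. X w A = \<chi> A))
       \<and> real (k choose r) * (ln (real (card \<Omega>)) / real (card V choose r) - \<delta>)
           \<le> (\<Sum>A\<in>nsets U r. ln (real (card (Ch A)))))"
    using rich_box_exists [OF assms(1) r_pos assms(2) num_colours_pos] by blast
  show ?thesis
  proof (intro exI [of _ "max n0 k"] allI impI)
    fix V :: "'a set" assume V: "finite V" "max n0 k \<le> card V" "members V \<noteq> {}"
    obtain U where U: "U \<subseteq> V" "card U = k" using obtain_subset_with_card_n [of k V] V(2) by auto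
    have finU: "finite U" using U V(1) finite_subset by blast
    have U_ne: "U \<noteq> {}" using U(2) assms(2) r_pos by auto
    have rV: "r \<le> card V" using V(2) assms(2) by simp
    have n0V: "n0 \<le> card V" using V(2) by simp
    have colours: "\<forall>A\<in>nsets V r. card ((\<lambda>N. Diag L N A) ` members V) \<le> num_colours"
      by (intro ballI card_Diags_le_num_colours)
    obtain C where box: "(\<forall>A\<in>nsets U r. C A \<noteq> {} \<and> C A \<subseteq> (\<lambda>N. Diag L N A) ` members V)
      \<and> (\<forall>\<chi>. (\<forall>A\<in>nsets U r. \<chi> A \<in> C A) \<longrightarrow> (\<exists>N\<in>members V. \<forall>A\<in>nsets U r. Diag L N A = \<chi> A))
      \<and> real (k choose r) * (ln (real (card (members V))) / real (card V choose r) - \<delta>)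
           \<le> (\<Sum>A\<in>nsets U r. ln (real (card (C A))))"
      using n0 [OF symmetric_submodular_entropy [OF V(1,3)] finite_members [OF V(1)] V(3)
        entropy_members [OF V(1,3) rV] colours U n0V] by (rule exE)
    note C = box [THEN conjunct1] and choices = box [THEN conjunct2, THEN conjunct1]
      and large = box [THEN conjunct2, THEN conjunct2]
    have restrict_U: "induced L N U \<in> members U" "\<And>A. A \<in> nsets U r \<Longrightarrow> Diag L (induced L N U) A = Diag L N A"
      if "N \<in> members V" for N
      using that induced_member [of N U] U(1) U_ne by (auto simp: members_def nsets_def Diag_induced)
    have C_nonempty: "C A \<noteq> {}" if "A \<in> nsets U r" for A using C that by blast
    have C_realised: "\<exists>N\<in>members U. Diag L N A = c" if A: "A \<in> nsets U r" "c \<in> C A" for A c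
    proof -
      obtain N where "N \<in> members V" "Diag L N A = c" using C A by blast
      then show ?thesis using restrict_U [of N] A(1) by blast
    qed
    have choices_realised: "\<exists>N\<in>members U. \<forall>A\<in>nsets U r. Diag L N A = \<chi> A"
      if \<chi>: "\<And>A. A \<in> nsets U r \<Longrightarrow> \<chi> A \<in> C A" for \<chi>
    proof -
      obtain N where "N \<in> members V" "\<forall>A\<in>nsets U r. Diag L N A = \<chi> A" using choices \<chi> by blast
      then show ?thesis using restrict_U [of N] by (intro bexI [of _ "induced L N U"]) auto
    qed
    note template = box_template_random [OF finU U(2) assms(2) C_nonempty C_realised choices_realised]
    have C_pos: "1 \<le> card (C A)" if "A \<in> nsets U r" for A
    proof -
      have "finite (C A)" using C that finite_members [OF V(1)] by (meson finite_imageI finite_subset)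
      then show ?thesis using C_nonempty [OF that] by (simp add: Suc_le_eq card_gt_0_iff)
    qed
    define P where "P = (\<Prod>A\<in>nsets U r. card (C A))"
    have "P \<le> ex_num L r k H"
      unfolding P_def using template(2) sub_num_le_ex_num [OF template(1) assms(2)] by (rule le_trans)
    moreover have "1 \<le> P" unfolding P_def using C_pos by (intro prod_ge_1) auto
    ultimately have ex1: "1 \<le> ex_num L r k H" and "ln (real P) \<le> ln (real (ex_num L r k H))"
      by simp_all
    moreover have "ln (real P) = (\<Sum>A\<in>nsets U r. ln (real (card (C A))))"
      unfolding P_def of_nat_prod using finite_imp_finite_nsets [OF finU] C_pos by (subst ln_prod) fastforce+
    ultimately show "1 \<le> ex_num L r k H \<and>
      real (k choose r) * (ln (real (card (members V))) / real (card V choose r) - \<delta>) \<le> ln (real (ex_num L r k H))"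
      using large ex1 by simp
  qed
qed

lemma members_empty_mono:
  assumes "members V' = {}" "V' \<subseteq> V" "V' \<noteq> {}"
  shows "members V = {}"
proof (rule ccontr)
  assume "members V \<noteq> {}"
  then obtain N where "N \<in> H" "universe N = V" by (auto simp: members_def)
  then have "induced L N V' \<in> members V'" using assms induced_member by (auto simp: members_def)
  then show False using assms(1) by simp
qed

end

text \<open>The limit is the infimum of \<open>b\<close>: from below \<open>b\<close> cannot drop under it, and from above \<open>a\<close>, hence \<open>b\<close>,
  eventually comes close to every value of \<open>b\<close>.\<close>

lemma squeeze_to_infimum:
  fixes a b :: "nat \<Rightarrow> real"
  assumes "\<And>k. k \<ge> r \<Longrightarrow> 0 \<le> b k" "\<And>k. k \<ge> r \<Longrightarrow> b k \<le> a k"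
    and ev: "\<And>k \<delta>. k \<ge> r \<Longrightarrow> \<delta> > 0 \<Longrightarrow> \<exists>n0. \<forall>n\<ge>n0. a n \<le> b k + \<delta>"
  shows "\<exists>h. 0 \<le> h \<and> a \<longlonglongrightarrow> h \<and> b \<longlonglongrightarrow> h"
proof -
  define h where "h = (INF k\<in>{r..}. b k)"
  have bdd: "bdd_below (b ` {r..})" using assms(1) by (intro bdd_belowI [of _ 0]) auto
  have h: "0 \<le> h" unfolding h_def using assms(1) by (intro cINF_greatest) auto
  have hb: "h \<le> b n" if "n \<ge> r" for n unfolding h_def using bdd that by (intro cINF_lower) auto
  have up: "\<exists>n0\<ge>r. \<forall>n\<ge>n0. a n < h + \<epsilon>" if \<epsilon>: "\<epsilon> > 0" for \<epsilon>
  proof -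
    have "\<exists>k\<in>{r..}. b k < h + \<epsilon> / 2"
      unfolding h_def using \<epsilon> bdd cINF_less_iff [of "{r..}" b "h + \<epsilon> / 2"] by (simp add: h_def)
    then obtain k where k: "k \<ge> r" "b k < h + \<epsilon> / 2" by auto
    obtain n0 where "\<forall>n\<ge>n0. a n \<le> b k + \<epsilon> / 2" using ev [OF k(1), of "\<epsilon> / 2"] \<epsilon> by auto
    then show ?thesis using k(2) by (intro exI [of _ "max n0 r"]) fastforce
  qed
  have "a \<longlonglongrightarrow> h"
  proof (rule LIMSEQ_I)
    fix \<epsilon> :: real assume "\<epsilon> > 0"
    then obtain n0 where n0: "n0 \<ge> r" "\<forall>n\<ge>n0. a n < h + \<epsilon>" using up by blast
    then show "\<exists>no. \<forall>n\<ge>no. norm (a n - h) < \<epsilon>"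
      using hb assms(2) \<open>\<epsilon> > 0\<close> by (intro exI [of _ n0]) (smt (verit) le_trans real_norm_def)
  qed
  moreover have "b \<longlonglongrightarrow> h"
  proof (rule tendsto_sandwich [OF _ _ tendsto_const \<open>a \<longlonglongrightarrow> h\<close>])
    show "\<forall>\<^sub>F n in sequentially. h \<le> b n" "\<forall>\<^sub>F n in sequentially. b n \<le> a n"
      using hb assms(2) by (auto intro: eventually_sequentiallyI [of r])
  qed
  ultimately show ?thesis using h by blast
qed

text \<open>Apply the squeezing lemma to the normalised logarithms of \<open>card (members (f n))\<close> and \<open>ex_num L r n H\<close>.
  The sets \<open>f n\<close> merely provide vertex sets of every size.\<close>

lemma (in relational_property) enumeration_limits:
  assumes ne: "\<And>V. finite V \<Longrightarrow> V \<noteq> {} \<Longrightarrow> members V \<noteq> {}"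
    and f: "\<And>n. finite (f n :: 'a set)" "\<And>n. card (f n) = n"
  shows "\<exists>h\<ge>0. (\<lambda>n. ln (real (card (members (f n)))) / real (n choose r)) \<longlonglongrightarrow> h \<and> pi_lim L r H = exp h"
proof -
  let ?m = "\<lambda>n. card (members (f n))"
  define a where "a = (\<lambda>n. ln (real (?m n)) / real (n choose r))"
  define b where "b = (\<lambda>n. ln (real (ex_num L r n H)) / real (n choose r))"
  have mne: "members (f n) \<noteq> {}" if "n \<ge> 1" for n
    using ne [OF f(1), of n] f(2) [of n] that by fastforce
  have key: "1 \<le> ex_num L r k H \<and> (\<exists>n0. \<forall>n\<ge>n0. a n \<le> b k + \<delta>)" if k: "k \<ge> r" and \<delta>: "\<delta> > 0" for k \<delta>
  proof -
    obtain n0 where n0: "\<And>V. finite V \<Longrightarrow> n0 \<le> card V \<Longrightarrow> members V \<noteq> {} \<Longrightarrow>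
      1 \<le> ex_num L r k H \<and>
      real (k choose r) * (ln (real (card (members V))) / real (card V choose r) - \<delta>) \<le> ln (real (ex_num L r k H))"
      using members_rate_le_ex_rate [OF \<delta> k] by blast
    have Kpos: "real (k choose r) > 0" using k by simp
    have *: "1 \<le> ex_num L r k H \<and> a n \<le> b k + \<delta>" if n: "n \<ge> max n0 1" for n
    proof -
      have "1 \<le> ex_num L r k H \<and> real (k choose r) * (a n - \<delta>) \<le> ln (real (ex_num L r k H))"
        using n0 [of "f n"] f mne [of n] n by (simp add: a_def)
      then show ?thesis
        using Kpos by (simp add: b_def pos_le_divide_eq mult.commute flip: diff_le_eq)
    qed
    then show ?thesis by blast
  qed
  have ex1: "1 \<le> ex_num L r k H" if "k \<ge> r" for k using key [OF that, of 1] by simp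
  have "\<exists>h. 0 \<le> h \<and> a \<longlonglongrightarrow> h \<and> b \<longlonglongrightarrow> h"
  proof (rule squeeze_to_infimum)
    fix k assume k: "k \<ge> r"
    show "0 \<le> b k" unfolding b_def using ex1 [OF k] by simp
    have "real (ex_num L r k H) \<le> real (?m k)"
      using ex_num_le_members [OF f k] by simp
    then show "b k \<le> a k"
      unfolding a_def b_def using ex1 [OF k] by (intro divide_right_mono) auto
  qed (use key in blast)
  then obtain h where h: "0 \<le> h" "a \<longlonglongrightarrow> h" "b \<longlonglongrightarrow> h" by blast
  have "(\<lambda>n. exp (b n)) \<longlonglongrightarrow> exp h" using h(3) by (rule tendsto_exp)
  moreover have "eventually (\<lambda>n. exp (b n) = root (n choose r) (real (ex_num L r n H))) sequentially"
    using eventually_ge_at_top [of r]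
  proof eventually_elim
    case (elim n)
    then have "n choose r > 0" by simp
    then show ?case
      using ex1 [OF elim] by (subst root_powr_inverse) (auto simp: b_def powr_def)
  qed
  ultimately have "(\<lambda>n. root (n choose r) (real (ex_num L r n H))) \<longlonglongrightarrow> exp h"
    by (rule Lim_transform_eventually)
  then have "pi_lim L r H = exp h" unfolding pi_lim_def by (rule limI)
  then show ?thesis using h unfolding a_def by blast
qed

theorem theorem3:
  fixes L :: "'s rel_lang" and H :: "('s, nat) rel_struct set" and r :: nat
  assumes "finite (symbols L)" and "symbols L \<noteq> {}"
    and "Max (sym_arity L ` symbols L) = r" and "r \<ge> 2"
    and "hereditary_property L H"
  shows "(pi_lim L r H > 1 \<longrightarrow>
           (\<exists>g \<in> o(\<lambda>n. real n ^ r). \<forall>\<^sub>F n in sequentially.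
              real (card (members_on H n)) = pi_lim L r H powr (real (n choose r) + g n)))
       \<and> (pi_lim L r H \<le> 1 \<longrightarrow>
           (\<forall>\<eta>>0. \<forall>\<^sub>F n in sequentially.
              real (card (members_on H n)) \<le> 2 powr (\<eta> * real n ^ r)))"
proof -
  interpret relational_property L H r
    using assms by unfold_locales auto
  have on: "members_on H n = members {1..n}" for n
    by (simp add: members_on_def members_def)
  show ?thesis
  proof (cases "\<exists>n\<ge>1. members {1..n} = {}")
    case True
    then obtain n0 where n0: "n0 \<ge> 1" "members {1..n0} = {}" by blast
    have empty: "members_on H n = {}" if "n \<ge> n0" for n
      using members_empty_mono [OF n0(2), of "{1..n}"] n0(1) that by (auto simp: on)
    have "eventually (\<lambda>n. 0 = root (n choose r) (real (ex_num L r n H))) sequentially"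
      using eventually_ge_at_top [of "max n0 r"]
    proof eventually_elim
      case (elim n)
      then have "ex_num L r n H = 0"
        using ex_num_le_members [of "{1..n}" n] empty [of n] by (simp add: on)
      then show ?case by simp
    qed
    then have "(\<lambda>n. root (n choose r) (real (ex_num L r n H))) \<longlonglongrightarrow> 0"
      by (rule Lim_transform_eventually [OF tendsto_const])
    then have "pi_lim L r H = 0" unfolding pi_lim_def by (rule limI)
    moreover have "\<forall>\<^sub>F n in sequentially. real (card (members_on H n)) \<le> 2 powr (\<eta> * real n ^ r)" for \<eta>
      using eventually_ge_at_top [of n0] by eventually_elim (simp add: empty)
    ultimately show ?thesis by simp
  next
    case False
    have ne: "members V \<noteq> {}" if "finite V" "V \<noteq> {}" for V :: "nat set"
    proof -
      have "card V \<ge> 1" using that by (simp add: Suc_le_eq card_gt_0_iff)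
      moreover have "finite (members {1..card V})" by (rule finite_members) simp
      ultimately have "card (members {1..card V}) \<noteq> 0" using False by auto
      then show ?thesis using card_members_eq [of V "{1..card V}"] that by auto
    qed
    define a where "a = (\<lambda>n. ln (real (card (members_on H n))) / real (n choose r))"
    obtain h where h: "h \<ge> 0" "a \<longlonglongrightarrow> h" "pi_lim L r H = exp h"
      using enumeration_limits [OF ne, of "\<lambda>n. {1..n}"] by (auto simp: a_def on)
    have count: "real (card (members_on H n)) = exp (real (n choose r) * a n)" if n: "n \<ge> max 1 r" for n
    proof -
      have "card (members_on H n) > 0"
        using ne [of "{1..n}"] finite_members [of "{1..n}"] n by (simp add: on card_gt_0_iff)
      moreover have "real (n choose r) > 0" using n by simp
      ultimately show ?thesis by (simp add: a_def)
    qed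
    have binom: "real (n choose r) \<le> real n ^ r" if "n \<ge> r" for n
      using binomial_le_pow [OF that] by (simp flip: of_nat_power)
    show ?thesis
    proof (intro conjI impI allI)
      assume "pi_lim L r H > 1"
      then have hpos: "h > 0" using h(3) by simp
      \<comment> \<open>The exponent error that turns \<open>exp h powr (real (n choose r) + g n)\<close> into \<open>exp (real (n choose r) * a n)\<close>.\<close>
      define g where "g = (\<lambda>n. real (n choose r) * (a n / h - 1))"
      have "(\<lambda>n. a n / h - 1) \<longlonglongrightarrow> h / h - 1"
        using hpos by (intro tendsto_intros h(2)) auto
      then have lim0: "(\<lambda>n. a n / h - 1) \<longlonglongrightarrow> 0" using hpos by simp
      have "(\<lambda>n. g n / real n ^ r) \<longlonglongrightarrow> 0"
      proof (rule tendsto_0_le [OF lim0, where K = 1])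
        show "\<forall>\<^sub>F n in sequentially. norm (g n / real n ^ r) \<le> norm (a n / h - 1) * 1"
          using eventually_ge_at_top [of "max 1 r"]
        proof eventually_elim
          case (elim n)
          then have "real n ^ r > 0" "real (n choose r) \<le> real n ^ r" using binom by auto
          then have "real (n choose r) / real n ^ r \<le> 1" by simp
          then have "\<bar>a n / h - 1\<bar> * (real (n choose r) / real n ^ r) \<le> \<bar>a n / h - 1\<bar> * 1"
            by (intro mult_left_mono) auto
          then show ?case by (simp add: g_def abs_mult mult.commute)
        qed
      qed
      then have "g \<in> o(\<lambda>n. real n ^ r)"
        using eventually_gt_at_top [of "0::nat"]
        by (intro smalloI_tendsto) (auto elim: eventually_mono)
      moreover have "\<forall>\<^sub>F n in sequentially.
          real (card (members_on H n)) = pi_lim L r H powr (real (n choose r) + g n)"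
        using eventually_ge_at_top [of "max 1 r"]
      proof eventually_elim
        case (elim n)
        have "(real (n choose r) + g n) * h = real (n choose r) * a n"
          using hpos by (simp add: g_def field_simps)
        then show ?case using count [OF elim] by (simp add: h(3) powr_def)
      qed
      ultimately show "\<exists>g \<in> o(\<lambda>n. real n ^ r). \<forall>\<^sub>F n in sequentially.
              real (card (members_on H n)) = pi_lim L r H powr (real (n choose r) + g n)" by blast
    next
      fix \<eta> :: real assume "pi_lim L r H \<le> 1" and \<eta>: "\<eta> > 0"
      then have "h = 0" using h(1,3) by simp
      then have "\<forall>\<^sub>F n in sequentially. a n < \<eta> * ln 2"
        using h(2) \<eta> by (intro order_tendstoD) auto
      then show "\<forall>\<^sub>F n in sequentially. real (card (members_on H n)) \<le> 2 powr (\<eta> * real n ^ r)"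
        using eventually_ge_at_top [of "max 1 r"]
      proof eventually_elim
        case (elim n)
        have "real (n choose r) * a n \<le> real (n choose r) * (\<eta> * ln 2)"
          using elim(1) by (intro mult_left_mono) auto
        also have "\<dots> \<le> real n ^ r * (\<eta> * ln 2)"
          using binom [of n] elim(2) \<eta> by (intro mult_right_mono) auto
        finally show ?case
          using count [OF elim(2)] by (simp add: powr_def mult_ac)
      qed
    qed
  qed
qed

end
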